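(* Let $u,v,w\in W$ and let $r=r_\alpha$ be the reflection through a simple root $\alpha$, such that $ur>u$, $vr>v$ and $wr>w$. Then $$ c_{w,vr}^u = c_{wr,vr}^{ur} + c_{wr,v}^u - (w\cdot \alpha)\, c_{w,v}^u + \sum_{\substack{\beta\in\Delta_+:\ w'=wr_\beta \text{ covers } w,\\ w'\neq wr}} \langle \alpha,\beta \rangle\, c_{w',v}^u , $$ an identity in $H$.
   Context: Let $G$ be a connected complex semisimple Lie group of adjoint type, with opposite Borel subgroups $B,B_-$, maximal torus $T^{\mathbb C}=B\cap B_-$ with maximal compact subtorus $T$, set of roots $\Delta$, positive roots $\Delta_+$, and Weyl group $W$. For $\beta\in\Delta$, $r_\beta\in W$ is the corresponding reflection. Let $l$ be the length function on $W$ and $\geq$ the (strong) Bruhat order; $w'$ covers $w$ if $w'>w$ and $l(w')=l(w)+1$. Let $H=H^*_T(pt)$, the polynomial ring over $\mathbb Z$ in the simple roots (each simple root has degree $2$), with its natural action of $W$; every root is regarded as an element of $H$. For roots $\alpha,\beta$, put $\langle\alpha,\beta\rangle:=(\alpha-r_\beta\alpha)/\beta\in\mathbb Z$. Combinatorial model of $H^*_T(G/B)$: a class $p$ is a list $\{p|_w\}_{w\in W}$ of elements of $H$ satisfying the GKM conditions: $p|_v-p|_{r_\beta v}$ is a multiple of $\beta$ in $H$ for all $v\in W$, $\beta\in\Delta$. Classes form an $H$-algebra under pointwise operations, identified with $H^*_T(G/B)$ by restriction to $T$-fixed points. The equivariant Schubert class $S_w$ (the class of $X_w=\overline{B_-wB}$)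 is the unique class that is homogeneous of degree $2l(w)$ (i.e. polynomial degree $l(w)$), satisfies $S_w|_v=0$ whenever $l(v)\le l(w)$ and $v\ne w$, and has $S_w|_w=\prod_{\beta\in\Delta_+,\ r_\beta w<w}\beta$. It satisfies $S_w|_v=0$ unless $v\geq w$, and $\{S_w\}_{w\in W}$ is an $H$-basis of the ring of classes. The structure constants $c_{wv}^u=c_{w,v}^u\in H$ are defined by $S_wS_v=\sum_{u\in W}c_{wv}^u S_u$. *)

theory Defs
  imports "HOL-Analysis.Analysis" "HOL-Library.Poly_Mapping"
begin

text \<open>
  A connected complex semisimple group of adjoint type with a chosen maximal torus and Borel
  subgroup enters only through its root system \<open>\<Phi>\<close> and its base of simple roots, given as an
  injective family \<open>\<alpha> :: 'i \<Rightarrow> 'v\<close>. Adjoint type means that the character lattice of the torus is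
  the root lattice, so that \<open>H\<close> is the polynomial ring over the integers in the simple roots.
\<close>

definition reflection :: "'v::euclidean_space \<Rightarrow> 'v \<Rightarrow> 'v"
  where "reflection \<beta> x = x - (2 * (x \<bullet> \<beta>) / (\<beta> \<bullet> \<beta>)) *\<^sub>R \<beta>"

definition root_system :: "'v::euclidean_space set \<Rightarrow> bool"
  where "root_system \<Phi> \<longleftrightarrow>
    finite \<Phi> \<and> 0 \<notin> \<Phi> \<and> span \<Phi> = UNIV \<and>
    (\<forall>\<beta>\<in>\<Phi>. reflection \<beta> ` \<Phi> \<subseteq> \<Phi>) \<and>
    (\<forall>\<beta>\<in>\<Phi>. \<forall>\<gamma>\<in>\<Phi>. 2 * (\<gamma> \<bullet> \<beta>) / (\<beta> \<bullet> \<beta>) \<in> \<int>) \<and>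
    (\<forall>\<beta>\<in>\<Phi>. \<forall>k. k *\<^sub>R \<beta> \<in> \<Phi> \<longrightarrow> k = 1 \<or> k = -1)"

definition simple_roots :: "'v::euclidean_space set \<Rightarrow> ('i::finite \<Rightarrow> 'v) \<Rightarrow> bool"
  where "simple_roots \<Phi> \<alpha> \<longleftrightarrow>
    inj \<alpha> \<and> range \<alpha> \<subseteq> \<Phi> \<and> independent (range \<alpha>) \<and>
    (\<forall>\<beta>\<in>\<Phi>. \<exists>n :: 'i \<Rightarrow> nat.
      \<beta> = (\<Sum>i\<in>UNIV. real (n i) *\<^sub>R \<alpha> i) \<or> \<beta> = - (\<Sum>i\<in>UNIV. real (n i) *\<^sub>R \<alpha> i))"

text \<open>For roots \<open>\<beta>\<close> and \<open>\<gamma>\<close>, the integer \<open>(\<beta> - r\<^sub>\<gamma> \<beta>) / \<gamma>\<close>.\<close>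

definition pairing :: "'v::euclidean_space \<Rightarrow> 'v \<Rightarrow> int"
  where "pairing \<beta> \<gamma> = (THE n. \<beta> - reflection \<gamma> \<beta> = of_int n *\<^sub>R \<gamma>)"

text \<open>
  \<open>H\<close>: the variable with index \<open>i\<close> is the simple root \<open>\<alpha> i\<close>. Polynomial degrees are used below;
  the cohomological degree is twice the polynomial degree.
\<close>

type_synonym 'i H = "('i \<Rightarrow>\<^sub>0 nat) \<Rightarrow>\<^sub>0 int"

definition Var :: "'i \<Rightarrow> 'i H"
  where "Var i = Poly_Mapping.single (Poly_Mapping.single i 1) 1"

definition homogeneous :: "nat \<Rightarrow> 'i::finite H \<Rightarrow> bool"
  where "homogeneous d f \<longleftrightarrow>
    (\<forall>m\<in>Poly_Mapping.keys f. (\<Sum>i\<in>UNIV. Poly_Mapping.lookup m i) = d)"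

text \<open>An element of the root lattice, in particular a root, regarded as an element of \<open>H\<close>.\<close>

definition root_coeff :: "('i::finite \<Rightarrow> 'v::euclidean_space) \<Rightarrow> 'v \<Rightarrow> 'i \<Rightarrow> int"
  where "root_coeff \<alpha> x = (THE n. x = (\<Sum>i\<in>UNIV. of_int (n i) *\<^sub>R \<alpha> i))"

definition root_poly :: "('i::finite \<Rightarrow> 'v::euclidean_space) \<Rightarrow> 'v \<Rightarrow> 'i H"
  where "root_poly \<alpha> x = (\<Sum>i\<in>UNIV. of_int (root_coeff \<alpha> x i) * Var i)"

text \<open>
  The action of \<open>w\<close> on \<open>H\<close>: the ring endomorphism sending each simple root to its image under \<open>w\<close>.
\<close>

definition act :: "('i::finite \<Rightarrow> 'v::euclidean_space) \<Rightarrow> ('v \<Rightarrow> 'v) \<Rightarrow> 'i H \<Rightarrow> 'i H"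
  where "act \<alpha> w f = (\<Sum>m\<in>Poly_Mapping.keys f. of_int (Poly_Mapping.lookup f m) *
    (\<Prod>i\<in>UNIV. root_poly \<alpha> (w (\<alpha> i)) ^ Poly_Mapping.lookup m i))"

context
  fixes \<Phi> :: "'v::euclidean_space set" and \<alpha> :: "'i::finite \<Rightarrow> 'v"
begin

definition pos_roots :: "'v set"
  where "pos_roots = {\<beta>\<in>\<Phi>. \<exists>n :: 'i \<Rightarrow> nat. \<beta> = (\<Sum>i\<in>UNIV. real (n i) *\<^sub>R \<alpha> i)}"

inductive_set weyl :: "('v \<Rightarrow> 'v) set"
  where weyl_id: "id \<in> weyl"
  | weyl_reflection: "w \<in> weyl \<Longrightarrow> \<beta> \<in> \<Phi> \<Longrightarrow> reflection \<beta> \<circ> w \<in> weyl"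

definition len :: "('v \<Rightarrow> 'v) \<Rightarrow> nat"
  where "len w =
    (LEAST n. \<exists>is. length is = n \<and> w = foldr (\<lambda>i x. reflection (\<alpha> i) \<circ> x) is id)"

definition bruhat_less :: "('v \<Rightarrow> 'v) \<Rightarrow> ('v \<Rightarrow> 'v) \<Rightarrow> bool"
  where "bruhat_less =
    (\<lambda>x y. x \<in> weyl \<and> (\<exists>\<beta>\<in>\<Phi>. y = reflection \<beta> \<circ> x) \<and> len x < len y)\<^sup>+\<^sup>+"

definition covers :: "('v \<Rightarrow> 'v) \<Rightarrow> ('v \<Rightarrow> 'v) \<Rightarrow> bool"
  where "covers w' w \<longleftrightarrow> bruhat_less w w' \<and> len w' = len w + 1"

text \<open>
  A class is a family indexed by the Weyl group. It is represented by a function that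
  is \<open>0\<close> off the Weyl group, so that equality of classes is equality of functions.
\<close>

definition gkm_class :: "(('v \<Rightarrow> 'v) \<Rightarrow> 'i H) \<Rightarrow> bool"
  where "gkm_class p \<longleftrightarrow>
    (\<forall>v\<in>weyl. \<forall>\<beta>\<in>\<Phi>. root_poly \<alpha> \<beta> dvd p v - p (reflection \<beta> \<circ> v)) \<and>
    (\<forall>v. v \<notin> weyl \<longrightarrow> p v = 0)"

definition is_schubert_class :: "('v \<Rightarrow> 'v) \<Rightarrow> (('v \<Rightarrow> 'v) \<Rightarrow> 'i H) \<Rightarrow> bool"
  where "is_schubert_class w p \<longleftrightarrow>
    gkm_class p \<and>
    (\<forall>v\<in>weyl. homogeneous (len w) (p v)) \<and>
    (\<forall>v\<in>weyl. len v \<le> len w \<and> v \<noteq> w \<longrightarrow> p v = 0) \<and>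
    p w = (\<Prod>\<beta> | \<beta> \<in> pos_roots \<and> bruhat_less (reflection \<beta> \<circ> w) w. root_poly \<alpha> \<beta>)"

definition schubert :: "('v \<Rightarrow> 'v) \<Rightarrow> ('v \<Rightarrow> 'v) \<Rightarrow> 'i H"
  where "schubert w = (THE p. is_schubert_class w p)"

text \<open>\<open>struct_const w v u\<close> is the coefficient of \<open>S\<^sub>u\<close> in \<open>S\<^sub>w S\<^sub>v\<close>.\<close>

definition struct_const :: "('v \<Rightarrow> 'v) \<Rightarrow> ('v \<Rightarrow> 'v) \<Rightarrow> ('v \<Rightarrow> 'v) \<Rightarrow> 'i H"
  where "struct_const w v = (THE c.
    (\<forall>x\<in>weyl. schubert w x * schubert v x = (\<Sum>u\<in>weyl. c u * schubert u x)) \<and>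
    (\<forall>u. u \<notin> weyl \<longrightarrow> c u = 0))"

end

end

theory Submission
  imports Defs "HOL-Computational_Algebra.Polynomial"
begin

text \<open>
  Write \<open>r\<close> for the reflection in the simple root \<open>\<alpha>\<close>. The right divided difference
  \<open>(\<partial>p)(v) = (p(vr) - p(v)) / (v \<alpha>)\<close> sends \<open>S\<^bsub>wr\<^esub>\<close> to \<open>S\<^sub>w\<close> and kills \<open>S\<^sub>w\<close> whenever \<open>wr > w\<close>.
  Its Leibniz rule gives \<open>\<partial>(S\<^bsub>wr\<^esub> S\<^bsub>vr\<^esub>) = S\<^sub>w S\<^bsub>vr\<^esub> + S\<^bsub>wr\<^esub> S\<^sub>v + \<chi> S\<^sub>w S\<^sub>v\<close>, where \<open>\<chi>\<close> is the class
  \<open>v \<mapsto> v \<alpha>\<close>, and the coefficient of \<open>S\<^sub>u\<close> on the left is the structure constant at \<open>ur\<close>.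
  The product \<open>\<chi> S\<^sub>w\<close> is expanded by the equivariant Chevalley formula, whose term at \<open>wr\<close> is
  \<open>- 2 S\<^bsub>wr\<^esub>\<close>. Schubert classes are obtained by applying \<open>\<partial>\<close> repeatedly to a class supported at the
  longest element. Their uniqueness and the Chevalley formula rest on one vanishing principle: a class
  of degree \<open>d\<close> that is zero at all elements of length at most \<open>d\<close> is zero, because distinct positive
  roots are non-associated primes of \<open>H\<close>.
\<close>

subsection \<open>Substitution in polynomials\<close>

text \<open>The divided difference acts on the right, so it permutes the points without touching
  scalars: it is \<open>H\<close>-linear, and structure constants pass through it unchanged. A left
  divided difference would twist them by the action of the reflection.

  In the coefficient of \<open>S u\<close>, the Leibniz rule contributes
  \<open>C (w \<circ> r i) v u\<close> with factor -1 once solved for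
  \<open>C w (v \<circ> r i) u\<close>. The Chevalley term at \<open>w \<circ> r i\<close>
  contributes it again with factor \<open>pairing (\<alpha> i) (\<alpha> i) = 2\<close>. The total
  -1 + 2 = 1 is the plus sign of the theorem, and it explains why the sum omits that cover.

  Adjoint type enters through primality: the variables are the simple roots, and every root is a
  Weyl conjugate of one, hence the image of a variable under an automorphism of \<open>H\<close>. In
  the weight lattice of SL2 the root is twice a generator and is not prime over the
  integers.\<close>

definition subst :: "('i::finite \<Rightarrow> 'r::comm_ring_1) \<Rightarrow> 'i H \<Rightarrow> 'r"
  where "subst x f = (\<Sum>m\<in>Poly_Mapping.keys f. of_int (Poly_Mapping.lookup f m) *
    (\<Prod>i\<in>UNIV. x i ^ Poly_Mapping.lookup m i))"

text \<open>Cancellation can shrink the keys of a sum; a common finite index set lets all terms of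
  \<open>subst_add\<close> range over the same monomials.\<close>

lemma subst_superset:
  assumes "finite A" "Poly_Mapping.keys f \<subseteq> A"
  shows "subst x f = (\<Sum>m\<in>A. of_int (Poly_Mapping.lookup f m) *
    (\<Prod>i\<in>UNIV. x i ^ Poly_Mapping.lookup m i))"
  unfolding subst_def using assms
  by (intro sum.mono_neutral_left) (auto simp: in_keys_iff)

lemma subst_0 [simp]: "subst x 0 = 0"
  by (simp add: subst_def)

lemma subst_add: "subst x (f + g) = subst x f + subst x g"
proof -
  let ?A = "Poly_Mapping.keys f \<union> Poly_Mapping.keys g"
  have "Poly_Mapping.keys (f + g) \<subseteq> ?A"
    by (rule keys_add)
  then show ?thesis
    by (subst (1 2 3) subst_superset[of ?A]) (auto simp: lookup_add algebra_simps sum.distrib)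
qed

lemma subst_diff: "subst x (f - g) = subst x f - subst x g"
  using subst_add[of x "f - g" g] by simp

lemma subst_sum: "subst x (\<Sum>a\<in>A. f a) = (\<Sum>a\<in>A. subst x (f a))"
  by (induction A rule: infinite_finite_induct) (auto simp: subst_add)

lemma subst_monomial:
  "subst x (Poly_Mapping.single m 1) = (\<Prod>i\<in>UNIV. x i ^ Poly_Mapping.lookup m i)"
  by (simp add: subst_def)

lemma subst_1 [simp]: "subst x 1 = 1"
  by (simp add: subst_monomial flip: single_one)

text \<open>\<open>H\<close> is the free abelian group on its monomials, so differences reach every
  integer coefficient. Facts about substitution thereby reduce to monomials with coefficient
  1.\<close>

lemma H_induct [case_names zero monomial diff]:
  fixes f :: "'i H"
  assumes "P 0" "\<And>m. P (Poly_Mapping.single m 1)" "\<And>f g. P f \<Longrightarrow> P g \<Longrightarrow> P (f - g)"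
  shows "P f"
  using subset_UNIV[of "Poly_Mapping.keys f"]
  by (induction rule: frag_induction) (use assms in auto)

lemma subst_mult: "subst x (f * g) = subst x f * subst x g"
proof (induction f rule: H_induct)
  case (monomial m)
  show ?case
  proof (induction g rule: H_induct)
    case (monomial k)
    show ?case
      by (simp add: mult_single subst_monomial lookup_add power_add prod.distrib)
  qed (auto simp: algebra_simps subst_diff)
qed (auto simp: algebra_simps subst_diff)

lemma subst_power: "subst x (f ^ n) = subst x f ^ n"
  by (induction n) (auto simp: subst_mult)

lemma subst_prod: "subst x (\<Prod>a\<in>A. f a) = (\<Prod>a\<in>A. subst x (f a))"
  by (induction A rule: infinite_finite_induct) (auto simp: subst_mult)

lemma subst_of_int: "subst x (of_int n) = of_int n"
proof -
  have nat: "subst x (of_nat k) = of_nat k" for k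
    by (induction k) (auto simp: subst_add)
  show ?thesis
    by (cases n rule: int_diff_cases) (simp add: subst_diff nat)
qed

lemma subst_Var [simp]:
  fixes x :: "'i::finite \<Rightarrow> 'r::comm_ring_1"
  shows "subst x (Var i) = x i"
proof -
  have "(\<Prod>j\<in>UNIV. x j ^ Poly_Mapping.lookup (Poly_Mapping.single i 1) j) =
      (\<Prod>j\<in>UNIV. if j = i then x j else 1)"
    by (rule prod.cong) (auto simp: lookup_single)
  also have "\<dots> = x i"
    by simp
  finally show ?thesis
    by (simp add: Var_def subst_monomial)
qed

lemma Var_power: "Var i ^ n = Poly_Mapping.single (Poly_Mapping.single i n) 1"
  by (induction n) (auto simp: Var_def mult_single single_add[symmetric])

lemma prod_monomial:
  "(\<Prod>i\<in>A. Poly_Mapping.single (m i) 1) =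
    (Poly_Mapping.single (\<Sum>i\<in>A. m i) 1 :: ('a::comm_monoid_add) \<Rightarrow>\<^sub>0 'b::comm_semiring_1)"
  by (induction A rule: infinite_finite_induct) (auto simp: mult_single)

lemma monomial_sum_lookup:
  fixes m :: "'i::finite \<Rightarrow>\<^sub>0 nat"
  shows "(\<Sum>i\<in>UNIV. Poly_Mapping.single i (Poly_Mapping.lookup m i)) = m"
  by (rule poly_mapping_eqI) (simp add: lookup_sum lookup_single when_def)

lemma subst_Var_id: "subst Var f = f"
  by (induction f rule: H_induct)
    (auto simp: subst_diff subst_monomial Var_power prod_monomial monomial_sum_lookup)

text \<open>Ring operations respect congruence modulo \<open>d\<close>. Comparing the identity
  substitution with the one that sets a variable to zero shows that whatever the latter kills is a
  multiple of the variable.\<close>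

lemma subst_cong_dvd:
  assumes "\<And>j. d dvd x j - y j"
  shows "d dvd subst x f - subst y f"
proof (induction f rule: H_induct)
  case (monomial m)
  have pow: "d dvd x j ^ n - y j ^ n" for j n
  proof (induction n)
    case (Suc n)
    have "x j ^ Suc n - y j ^ Suc n = (x j - y j) * x j ^ n + y j * (x j ^ n - y j ^ n)"
      by (simp add: algebra_simps)
    then show ?case
      using Suc assms by auto
  qed auto
  have "d dvd (\<Prod>i\<in>A. x i ^ Poly_Mapping.lookup m i) - (\<Prod>i\<in>A. y i ^ Poly_Mapping.lookup m i)"
    if "finite A" for A
    using that
  proof (induction A)
    case (insert a A)
    have "(\<Prod>i\<in>insert a A. x i ^ Poly_Mapping.lookup m i) -
        (\<Prod>i\<in>insert a A. y i ^ Poly_Mapping.lookup m i) =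
      (x a ^ Poly_Mapping.lookup m a - y a ^ Poly_Mapping.lookup m a) *
        (\<Prod>i\<in>A. x i ^ Poly_Mapping.lookup m i) +
      y a ^ Poly_Mapping.lookup m a * ((\<Prod>i\<in>A. x i ^ Poly_Mapping.lookup m i) -
        (\<Prod>i\<in>A. y i ^ Poly_Mapping.lookup m i))"
      using insert by (simp add: algebra_simps)
    then show ?case
      using insert pow by auto
  qed auto
  then show ?case
    by (simp add: subst_monomial)
next
  case (diff f g)
  have "subst x (f - g) - subst y (f - g) = (subst x f - subst y f) - (subst x g - subst y g)"
    by (simp add: subst_diff)
  then show ?case
    using diff by (metis dvd_diff)
qed auto

text \<open>
  The library makes a ring of polynomial mappings a domain only if the keys are linearly ordered,
  so the variables are renamed to natural numbers.
\<close>

lemma H_mult_eq_0_iff: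
  fixes f g :: "'i::finite H"
  shows "f * g = 0 \<longleftrightarrow> f = 0 \<or> g = 0"
proof -
  obtain e :: "'i \<Rightarrow> nat" where e: "inj e"
    using finite_imp_inj_to_nat_seg[of "UNIV :: 'i set"] by auto
  define \<phi> :: "('i \<Rightarrow>\<^sub>0 nat) \<Rightarrow> (nat \<Rightarrow>\<^sub>0 nat)"
    where "\<phi> m = (\<Sum>i\<in>UNIV. Poly_Mapping.single (e i) (Poly_Mapping.lookup m i))" for m
  have lookup_\<phi>: "Poly_Mapping.lookup (\<phi> m) (e j) = Poly_Mapping.lookup m j" for m j
    using e by (simp add: \<phi>_def lookup_sum lookup_single when_def inj_eq)
  have \<phi>_eq: "\<phi> m = \<phi> k \<longleftrightarrow> m = k" for m k
    using lookup_\<phi> by (metis poly_mapping_eqI)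
  let ?s = "subst (\<lambda>i. Var (e i) :: nat H) :: 'i H \<Rightarrow> nat H"
  \<comment> \<open>Since \<open>\<phi>\<close> is injective on exponents, each coefficient of
    \<open>h\<close> survives at the renamed monomial. Hence \<open>?s\<close> has trivial
    kernel.\<close>
  have lookup_s: "Poly_Mapping.lookup (?s h) (\<phi> m) = Poly_Mapping.lookup h m" for h m
  proof (induction h rule: H_induct)
    case (monomial k)
    have "?s (Poly_Mapping.single k 1) = Poly_Mapping.single (\<phi> k) 1"
      by (simp add: subst_monomial Var_power prod_monomial \<phi>_def)
    then show ?case
      by (simp add: lookup_single \<phi>_eq)
  qed (auto simp: subst_diff lookup_minus)
  have inj: "h = 0" if "?s h = 0" for h
    using lookup_s[of h] that by (metis lookup_zero poly_mapping_eqI)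
  show ?thesis
  proof
    assume "f * g = 0"
    then have "?s f * ?s g = 0"
      by (metis subst_0 subst_mult)
    then have "?s f = 0 \<or> ?s g = 0"
      by (simp only: mult_eq_0_iff)
    then show "f = 0 \<or> g = 0"
      using inj by blast
  qed auto
qed

lemma H_mult_left_cancel:
  fixes f g h :: "'i::finite H"
  assumes "h \<noteq> 0"
  shows "h * f = h * g \<longleftrightarrow> f = g"
  using H_mult_eq_0_iff[of h "f - g"] assms by (simp add: right_diff_distrib)

lemma H_prod_nonzero:
  fixes f :: "'a \<Rightarrow> 'i::finite H"
  assumes "\<And>a. a \<in> A \<Longrightarrow> f a \<noteq> 0"
  shows "prod f A \<noteq> 0"
  using assms by (induction A rule: infinite_finite_induct) (auto simp: H_mult_eq_0_iff)

text \<open>Setting the variable to zero is a ring homomorphism into a domain, and its kernel is the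
  ideal generated by the variable. Primality of variables follows at once.\<close>

lemma Var_dvd_iff:
  "Var i dvd f \<longleftrightarrow> subst (\<lambda>j. if j = i then 0 else Var j) f = 0"
proof
  assume "Var i dvd f"
  then show "subst (\<lambda>j. if j = i then 0 else Var j) f = 0"
    by (auto simp: subst_mult dvd_def)
next
  assume 0: "subst (\<lambda>j. if j = i then 0 else Var j) f = 0"
  have "Var i dvd subst Var f - subst (\<lambda>j. if j = i then 0 else Var j) f"
    by (rule subst_cong_dvd) auto
  then show "Var i dvd f"
    by (simp add: 0 subst_Var_id)
qed

lemma Var_dvd_mult: "Var (i::'i::finite) dvd f * g \<Longrightarrow> Var i dvd f \<or> Var i dvd g"
  by (simp add: Var_dvd_iff subst_mult H_mult_eq_0_iff)

lemma lookup_linear_form: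
  fixes n :: "'i::finite \<Rightarrow> int"
  shows "Poly_Mapping.lookup (\<Sum>i\<in>UNIV. of_int (n i) * Var i :: 'i H) (Poly_Mapping.single j 1) = n j"
proof -
  have "of_int (n i) * Var i = Poly_Mapping.single (Poly_Mapping.single i 1) (n i)" for i
    unfolding Var_def single_of_int[symmetric] by (simp add: mult_single)
  moreover have "Poly_Mapping.single i 1 = Poly_Mapping.single j (1::nat) \<longleftrightarrow> i = j" for i
    by (metis keys_single insertI1 singletonD one_neq_zero)
  ultimately show ?thesis
    by (simp add: lookup_sum lookup_single when_def)
qed

lemma linear_form_eq_0_iff:
  fixes n :: "'i::finite \<Rightarrow> int"
  shows "(\<Sum>i\<in>UNIV. of_int (n i) * Var i :: 'i H) = 0 \<longleftrightarrow> (\<forall>i. n i = 0)"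
  using lookup_linear_form[of n] by (auto simp del: single_of_int)

lemma subst_subst: "subst y (subst x f) = subst (\<lambda>i. subst y (x i)) f"
  by (induction f rule: H_induct) (auto simp: subst_diff subst_monomial subst_prod subst_power)

lemma act_eq_subst: "act \<alpha> w = subst (\<lambda>i. root_poly \<alpha> (w (\<alpha> i)))"
  by (rule ext) (simp add: act_def subst_def)

subsection \<open>Homogeneous polynomials\<close>

text \<open>This is \<open>f(t x)\<close> in \<open>H[t]\<close>: the coefficient of
  \<open>t^d\<close> is the part of \<open>f\<close> of degree \<open>d\<close>. Being a ring
  homomorphism, it turns statements about degrees into comparisons of coefficients of univariate
  polynomials.\<close>

definition grading :: "'i::finite H \<Rightarrow> 'i H poly"
  where "grading = subst (\<lambda>i. monom (Var i) 1)"

lemma lookup_coeff_grading: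
  "Poly_Mapping.lookup (coeff (grading f) d) m =
    (if (\<Sum>i\<in>UNIV. Poly_Mapping.lookup m i) = d then Poly_Mapping.lookup f m else 0)"
proof (induction f rule: H_induct)
  case (monomial k)
  have "(\<Prod>i\<in>A. monom (Var i) 1 ^ Poly_Mapping.lookup k i) =
      monom (\<Prod>i\<in>A. Var i ^ Poly_Mapping.lookup k i) (\<Sum>i\<in>A. Poly_Mapping.lookup k i)" for A
    by (induction A rule: infinite_finite_induct) (auto simp: monom_power mult_monom)
  then have "grading (Poly_Mapping.single k 1) =
      monom (Poly_Mapping.single k 1) (\<Sum>i\<in>UNIV. Poly_Mapping.lookup k i)"
    by (simp add: grading_def subst_monomial Var_power prod_monomial monomial_sum_lookup)
  then show ?case
    by (auto simp: lookup_single when_def)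
qed (auto simp: grading_def subst_diff lookup_minus)

lemma homogeneous_iff_grading: "homogeneous d f \<longleftrightarrow> grading f = monom f d"
proof
  assume "homogeneous d f"
  then show "grading f = monom f d"
    by (intro poly_eqI poly_mapping_eqI)
      (auto simp: lookup_coeff_grading homogeneous_def in_keys_iff)
next
  assume *: "grading f = monom f d"
  show "homogeneous d f"
    unfolding homogeneous_def
  proof
    fix m
    assume "m \<in> Poly_Mapping.keys f"
    moreover have "Poly_Mapping.lookup (coeff (grading f) (\<Sum>i\<in>UNIV. Poly_Mapping.lookup m i)) m =
        Poly_Mapping.lookup f m"
      by (simp add: lookup_coeff_grading)
    ultimately show "(\<Sum>i\<in>UNIV. Poly_Mapping.lookup m i) = d"
      by (auto simp: * in_keys_iff split: if_splits)
  qed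
qed

lemma homogeneous_0 [simp]: "homogeneous d 0"
  by (simp add: homogeneous_def)

lemma homogeneous_1: "homogeneous 0 1"
  by (simp add: homogeneous_iff_grading grading_def monom_0 one_pCons)

lemma homogeneous_Var: "homogeneous 1 (Var i)"
  by (simp add: homogeneous_iff_grading grading_def)

lemma homogeneous_diff: "homogeneous d f \<Longrightarrow> homogeneous d g \<Longrightarrow> homogeneous d (f - g)"
  by (simp add: homogeneous_iff_grading grading_def subst_diff diff_monom)

lemma homogeneous_add: "homogeneous d f \<Longrightarrow> homogeneous d g \<Longrightarrow> homogeneous d (f + g)"
  by (simp add: homogeneous_iff_grading grading_def subst_add add_monom)

lemma homogeneous_sum: "(\<And>a. a \<in> A \<Longrightarrow> homogeneous d (f a)) \<Longrightarrow> homogeneous d (sum f A)"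
  by (induction A rule: infinite_finite_induct) (auto intro: homogeneous_add)

lemma homogeneous_mult: "homogeneous d f \<Longrightarrow> homogeneous e g \<Longrightarrow> homogeneous (d + e) (f * g)"
  by (simp add: homogeneous_iff_grading grading_def subst_mult mult_monom)

lemma homogeneous_of_int: "homogeneous 0 (of_int n)"
  by (simp add: homogeneous_iff_grading grading_def subst_of_int monom_0 of_int_poly)

lemma homogeneous_of_int_mult: "homogeneous d f \<Longrightarrow> homogeneous d (of_int n * f)"
  using homogeneous_mult[OF homogeneous_of_int] by fastforce

lemma homogeneous_prod:
  assumes "\<And>a. a \<in> A \<Longrightarrow> homogeneous 1 (f a)"
  shows "homogeneous (card A) (prod f A)"
  using assms
proof (induction A rule: infinite_finite_induct)
  case (insert a A)
  then show ?case
    using homogeneous_mult[of 1 "f a" "card A" "prod f A"] by simp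
qed (auto simp: homogeneous_1)

text \<open>Multiplication by \<open>monom g e\<close> moves all coefficients up by \<open>e\<close>
  places, so nothing is left at place \<open>d < e\<close>. The quotient is not assumed
  homogeneous.\<close>

lemma homogeneous_dvd_imp_0:
  assumes "homogeneous d f" "homogeneous e g" "d < e" "g dvd f"
  shows "f = 0"
proof -
  obtain q where q: "f = g * q"
    using assms by blast
  have "monom f d = monom g e * grading q"
    using assms(1,2) by (simp add: q homogeneous_iff_grading grading_def subst_mult)
  then have "coeff (monom f d) d = coeff (monom g e * grading q) d"
    by simp
  then show ?thesis
    using assms(3) by (simp add: coeff_monom_mult)
qed

text \<open>Each graded part of \<open>q\<close> is found by comparing the coefficients one place
  higher and cancelling \<open>g\<close>.\<close>

lemma homogeneous_quotient:
  fixes g q :: "'i::finite H"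
  assumes "homogeneous (Suc d) (g * q)" "homogeneous 1 g" "g \<noteq> 0"
  shows "homogeneous d q"
proof -
  have eq: "monom (g * q) (Suc d) = monom g 1 * grading q"
    using assms(1,2) by (simp add: homogeneous_iff_grading grading_def subst_mult)
  have "coeff (grading q) n = coeff (monom q d) n" for n
  proof -
    have "g * coeff (grading q) n = coeff (monom (g * q) (Suc d)) (Suc n)"
      unfolding eq by (simp add: coeff_monom_mult)
    also have "\<dots> = g * coeff (monom q d) n"
      by auto
    finally show ?thesis
      using assms(3) by (simp add: H_mult_left_cancel)
  qed
  then show ?thesis
    by (simp add: homogeneous_iff_grading poly_eqI)
qed

subsection \<open>Reflections and the Weyl group\<close>

lemma linear_reflection: "linear (reflection \<beta>)"
  by (rule linearI) (simp_all add: reflection_def algebra_simps add_divide_distrib)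

lemma reflection_neg [simp]: "reflection \<beta> (- x) = - reflection \<beta> x"
  by (simp add: reflection_def)

lemma reflection_uminus [simp]: "reflection (- \<beta>) = reflection \<beta>"
  by (rule ext) (simp add: reflection_def)

lemma reflection_self: "reflection \<beta> \<beta> = - \<beta>"
proof (cases "\<beta> = 0")
  case False
  then have "2 * (\<beta> \<bullet> \<beta>) / (\<beta> \<bullet> \<beta>) = 2"
    by simp
  then have "reflection \<beta> \<beta> = \<beta> - 2 *\<^sub>R \<beta>"
    unfolding reflection_def by (simp only:)
  then show ?thesis
    by (simp add: scaleR_2)
qed (simp add: reflection_def)

lemma reflection_involutive [simp]: "reflection \<beta> (reflection \<beta> x) = x"
proof (cases "\<beta> = 0")
  case False
  let ?c = "2 * (x \<bullet> \<beta>) / (\<beta> \<bullet> \<beta>)"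
  have "reflection \<beta> (x - ?c *\<^sub>R \<beta>) = reflection \<beta> x - ?c *\<^sub>R reflection \<beta> \<beta>"
    by (simp add: linear_reflection linear_diff linear_scale)
  then show ?thesis
    unfolding reflection_self by (simp add: reflection_def)
qed (simp add: reflection_def)

lemma reflection_comp_self_left [simp]: "reflection \<beta> \<circ> (reflection \<beta> \<circ> w) = w"
  by (simp add: fun_eq_iff)

lemma reflection_comp_self_right [simp]: "w \<circ> reflection \<beta> \<circ> reflection \<beta> = w"
  by (simp add: fun_eq_iff)

lemma inner_reflection: "reflection \<beta> x \<bullet> reflection \<beta> y = x \<bullet> y"
proof (cases "\<beta> = 0")
  case False
  then show ?thesis
    by (simp add: reflection_def inner_diff_left inner_diff_right inner_commute field_simps)
qed (simp add: reflection_def)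

lemma isometry_reflection:
  assumes "linear g" "\<And>x y. g x \<bullet> g y = x \<bullet> y"
  shows "g (reflection \<beta> x) = reflection (g \<beta>) (g x)"
  using assms by (simp add: reflection_def linear_diff linear_scale)

locale based_root_system =
  fixes \<Phi> :: "'v::euclidean_space set" and \<alpha> :: "'i::finite \<Rightarrow> 'v"
  assumes root_system: "root_system \<Phi>" and simple_roots: "simple_roots \<Phi> \<alpha>"
begin

abbreviation "W \<equiv> weyl \<Phi>"
abbreviation "P \<equiv> pos_roots \<Phi> \<alpha>"
abbreviation "L \<equiv> len \<alpha>"
abbreviation "r i \<equiv> reflection (\<alpha> i)"

lemma finite_roots: "finite \<Phi>"
  and zero_not_root: "0 \<notin> \<Phi>"
  and span_roots: "span \<Phi> = UNIV"
  and reflection_root: "\<beta> \<in> \<Phi> \<Longrightarrow> \<gamma> \<in> \<Phi> \<Longrightarrow> reflection \<beta> \<gamma> \<in> \<Phi>"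
  and cartan_int: "\<beta> \<in> \<Phi> \<Longrightarrow> \<gamma> \<in> \<Phi> \<Longrightarrow> 2 * (\<gamma> \<bullet> \<beta>) / (\<beta> \<bullet> \<beta>) \<in> \<int>"
  and reduced: "\<beta> \<in> \<Phi> \<Longrightarrow> k *\<^sub>R \<beta> \<in> \<Phi> \<Longrightarrow> k = 1 \<or> k = -1"
  using root_system unfolding root_system_def by blast+

lemma inj_simple: "inj \<alpha>"
  and simple_root [simp]: "\<alpha> i \<in> \<Phi>"
  and indep_simple: "independent (range \<alpha>)"
  and root_cases_nat: "\<beta> \<in> \<Phi> \<Longrightarrow> \<exists>n :: 'i \<Rightarrow> nat.
      \<beta> = (\<Sum>i\<in>UNIV. real (n i) *\<^sub>R \<alpha> i) \<or> \<beta> = - (\<Sum>i\<in>UNIV. real (n i) *\<^sub>R \<alpha> i)"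
  using simple_roots unfolding simple_roots_def by blast+

lemma root_uminus: "\<beta> \<in> \<Phi> \<Longrightarrow> - \<beta> \<in> \<Phi>"
  using reflection_root[of \<beta> \<beta>] by (simp add: reflection_self)

lemma weyl_linear: "w \<in> W \<Longrightarrow> linear w"
proof (induction rule: weyl.induct)
  case weyl_id
  show ?case
    by (rule linear_id)
next
  case (weyl_reflection w \<beta>)
  then show ?case
    using linear_compose linear_reflection by blast
qed

lemma weyl_inner: "w \<in> W \<Longrightarrow> w x \<bullet> w y = x \<bullet> y"
  by (induction rule: weyl.induct) (auto simp: inner_reflection)

lemma weyl_root: "w \<in> W \<Longrightarrow> \<beta> \<in> \<Phi> \<Longrightarrow> w \<beta> \<in> \<Phi>"
  by (induction rule: weyl.induct) (auto simp: reflection_root)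

lemma weyl_neg: "w \<in> W \<Longrightarrow> w (- x) = - w x"
  by (simp add: weyl_linear linear_neg)

text \<open>Conjugation trades right reflections for left ones: \<open>weyl\<close>,
  \<open>gkm_class\<close> and \<open>bruhat_less\<close> are built from left multiplication,
  whereas divided differences and the theorem multiply on the right.\<close>

lemma weyl_reflection_conj: "w \<in> W \<Longrightarrow> w \<circ> reflection \<beta> = reflection (w \<beta>) \<circ> w"
  by (simp add: fun_eq_iff isometry_reflection weyl_linear weyl_inner)

lemma reflection_in_weyl: "\<beta> \<in> \<Phi> \<Longrightarrow> reflection \<beta> \<in> W"
  using weyl_reflection[OF weyl_id, of \<beta> \<Phi>] by simp

lemma weyl_comp: "x \<in> W \<Longrightarrow> y \<in> W \<Longrightarrow> x \<circ> y \<in> W"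
  by (induction rule: weyl.induct) (auto simp: comp_assoc intro: weyl.intros)

lemma weyl_comp_reflection: "x \<in> W \<Longrightarrow> \<beta> \<in> \<Phi> \<Longrightarrow> x \<circ> reflection \<beta> \<in> W"
  by (simp add: weyl_comp reflection_in_weyl)

lemma weyl_inverse:
  assumes "w \<in> W"
  obtains z where "z \<in> W" "\<And>x. w (z x) = x" "\<And>x. z (w x) = x"
proof -
  have "\<exists>z\<in>W. (\<forall>x. w (z x) = x) \<and> (\<forall>x. z (w x) = x)"
    using assms
  proof (induction rule: weyl.induct)
    case weyl_id
    then show ?case
      using weyl.weyl_id by (intro bexI[of _ id]) auto
  next
    case (weyl_reflection w \<beta>)
    then obtain z where z: "z \<in> W" "\<forall>x. w (z x) = x" "\<forall>x. z (w x) = x"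
      by blast
    then show ?case
      using weyl_comp_reflection[OF z(1) weyl_reflection(2)]
      by (intro bexI[of _ "z \<circ> reflection \<beta>"]) auto
  qed
  then show ?thesis
    using that by blast
qed

lemma weyl_inj:
  assumes "w \<in> W"
  shows "w x = w y \<longleftrightarrow> x = y"
proof -
  obtain z where "\<And>x. z (w x) = x"
    using weyl_inverse[OF assms] by metis
  then show ?thesis
    by metis
qed

lemma comp_reflection_eq_iff:
  "x \<circ> reflection \<beta> = y \<longleftrightarrow> x = y \<circ> reflection \<beta>"
  by (auto simp: fun_eq_iff) (metis reflection_involutive)+

subsection \<open>Coordinates with respect to the simple roots\<close>

text \<open>Integer rather than natural coordinates, so that negatives, differences and Weyl images
  of roots keep the same form and positivity is a sign condition.\<close>

definition lat :: "('i \<Rightarrow> int) \<Rightarrow> 'v"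
  where "lat n = (\<Sum>i\<in>UNIV. of_int (n i) *\<^sub>R \<alpha> i)"

lemma simple_comb_eq_0:
  assumes "(\<Sum>i\<in>UNIV. c i *\<^sub>R \<alpha> i) = 0"
  shows "c i = 0"
proof -
  have "(\<Sum>x\<in>range \<alpha>. c (inv \<alpha> x) *\<^sub>R x) = (\<Sum>i\<in>UNIV. c i *\<^sub>R \<alpha> i)"
    using inj_simple by (subst sum.reindex) auto
  then have "c (inv \<alpha> (\<alpha> i)) = 0"
    using independentD[OF indep_simple, of "range \<alpha>" "\<lambda>x. c (inv \<alpha> x)"] assms by simp
  then show ?thesis
    using inj_simple by simp
qed

lemma lat_uminus: "- lat n = lat (\<lambda>i. - n i)"
  and lat_diff: "lat n - lat m = lat (\<lambda>i. n i - m i)"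
  and lat_scale: "of_int k *\<^sub>R lat n = lat (\<lambda>i. k * n i)"
  by (simp_all add: lat_def sum.distrib sum_negf sum_subtractf algebra_simps scaleR_sum_right)

lemma lat_eq_iff [simp]: "lat n = lat m \<longleftrightarrow> n = m"
proof
  assume "lat n = lat m"
  then have "lat (\<lambda>i. n i - m i) = 0"
    by (simp flip: lat_diff)
  then have "of_int (n i - m i) = (0::real)" for i
    unfolding lat_def by (rule simple_comb_eq_0)
  then show "n = m"
    by (auto simp: fun_eq_iff)
qed auto

lemma lat_eq_0_iff: "lat n = 0 \<longleftrightarrow> (\<forall>i. n i = 0)"
  using lat_eq_iff[of n "\<lambda>_. 0"] by (auto simp: lat_def fun_eq_iff)

lemma simple_root_lat: "\<alpha> i = lat (\<lambda>j. if j = i then 1 else 0)"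
proof -
  have "lat (\<lambda>j. if j = i then 1 else 0) = (\<Sum>j\<in>UNIV. if j = i then \<alpha> j else 0)"
    unfolding lat_def by (rule sum.cong) auto
  then show ?thesis
    by simp
qed

lemma weyl_lat:
  assumes "w \<in> W" "\<And>i. w (\<alpha> i) = lat (N i)"
  shows "w (lat n) = lat (\<lambda>j. \<Sum>i\<in>UNIV. n i * N i j)"
proof -
  have "w (lat n) = (\<Sum>i\<in>UNIV. of_int (n i) *\<^sub>R w (\<alpha> i))"
    unfolding lat_def
    by (simp only: linear_sum[OF weyl_linear[OF assms(1)]] linear_scale[OF weyl_linear[OF assms(1)]])
  also have "\<dots> = (\<Sum>i\<in>UNIV. \<Sum>j\<in>UNIV. of_int (n i * N i j) *\<^sub>R \<alpha> j)"
    by (simp only: assms(2) lat_def scaleR_sum_right scaleR_scaleR of_int_mult)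
  also have "\<dots> = (\<Sum>j\<in>UNIV. \<Sum>i\<in>UNIV. of_int (n i * N i j) *\<^sub>R \<alpha> j)"
    by (rule sum.swap)
  also have "\<dots> = lat (\<lambda>j. \<Sum>i\<in>UNIV. n i * N i j)"
    by (simp only: lat_def of_int_sum scaleR_sum_left)
  finally show ?thesis .
qed

lemma pos_root_iff: "\<beta> \<in> P \<longleftrightarrow> \<beta> \<in> \<Phi> \<and> (\<exists>n. (\<forall>i. n i \<ge> 0) \<and> \<beta> = lat n)"
proof -
  have "(\<exists>n :: 'i \<Rightarrow> nat. \<beta> = (\<Sum>i\<in>UNIV. real (n i) *\<^sub>R \<alpha> i)) \<longleftrightarrow> (\<exists>n. (\<forall>i. n i \<ge> 0) \<and> \<beta> = lat n)"
  proof
    assume "\<exists>n :: 'i \<Rightarrow> nat. \<beta> = (\<Sum>i\<in>UNIV. real (n i) *\<^sub>R \<alpha> i)"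
    then obtain n :: "'i \<Rightarrow> nat" where "\<beta> = (\<Sum>i\<in>UNIV. real (n i) *\<^sub>R \<alpha> i)"
      by blast
    then show "\<exists>n. (\<forall>i. n i \<ge> 0) \<and> \<beta> = lat n"
      by (intro exI[of _ "\<lambda>i. int (n i)"]) (auto simp: lat_def)
  next
    assume "\<exists>n. (\<forall>i. n i \<ge> 0) \<and> \<beta> = lat n"
    then obtain n where "\<forall>i. n i \<ge> 0" "\<beta> = lat n"
      by blast
    then show "\<exists>n :: 'i \<Rightarrow> nat. \<beta> = (\<Sum>i\<in>UNIV. real (n i) *\<^sub>R \<alpha> i)"
      by (intro exI[of _ "\<lambda>i. nat (n i)"]) (auto simp: lat_def)
  qed
  then show ?thesis
    by (auto simp: pos_roots_def)
qed

lemma pos_root_root: "\<beta> \<in> P \<Longrightarrow> \<beta> \<in> \<Phi>"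
  by (simp add: pos_root_iff)

lemma finite_pos_roots: "finite P"
  using finite_roots by (simp add: pos_roots_def)

lemma simple_pos [simp]: "\<alpha> i \<in> P"
  unfolding pos_root_iff
  by (auto intro!: exI[of _ "\<lambda>j. if j = i then 1 else 0"] simp: simple_root_lat[symmetric])

lemma root_cases:
  assumes "\<beta> \<in> \<Phi>"
  obtains "\<beta> \<in> P" | "- \<beta> \<in> P"
  using root_cases_nat[OF assms] assms root_uminus[OF assms] that
  unfolding pos_roots_def by force

lemma not_pos_neg: "\<beta> \<in> P \<Longrightarrow> - \<beta> \<notin> P"
proof
  assume "\<beta> \<in> P" "- \<beta> \<in> P"
  then obtain n m where nm: "\<forall>i. n i \<ge> 0" "\<beta> = lat n" "\<forall>i. m i \<ge> 0" "- \<beta> = lat m" "\<beta> \<in> \<Phi>"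
    unfolding pos_root_iff by blast
  then have eq: "m = (\<lambda>i. - n i)"
    by (simp add: lat_uminus)
  have "n i = 0" for i
    using nm(1,3) by (metis eq neg_0_le_iff_le order_antisym)
  then show False
    using nm zero_not_root by (metis lat_eq_0_iff)
qed

lemma pos_neg_iff: "\<beta> \<in> \<Phi> \<Longrightarrow> - \<beta> \<in> P \<longleftrightarrow> \<beta> \<notin> P"
  using root_cases not_pos_neg by blast

lemma root_lat: "\<beta> \<in> \<Phi> \<Longrightarrow> \<exists>n. \<beta> = lat n"
  using root_cases[of \<beta>] by (metis lat_uminus minus_minus pos_root_iff)

lemma reflection_int:
  assumes "\<beta> \<in> \<Phi>" "\<gamma> \<in> \<Phi>"
  obtains k :: int where "reflection \<beta> \<gamma> = \<gamma> - of_int k *\<^sub>R \<beta>" "of_int k = 2 * (\<gamma> \<bullet> \<beta>) / (\<beta> \<bullet> \<beta>)"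
proof -
  obtain k :: int where k: "2 * (\<gamma> \<bullet> \<beta>) / (\<beta> \<bullet> \<beta>) = of_int k"
    using cartan_int[OF assms] by (rule Ints_cases)
  then have "reflection \<beta> \<gamma> = \<gamma> - of_int k *\<^sub>R \<beta>"
    unfolding reflection_def by (simp only: k)
  then show ?thesis
    using that k[symmetric] by blast
qed

lemma simple_reflection_lat:
  assumes "lat n \<in> \<Phi>"
  obtains k where "r i (lat n) = lat (\<lambda>j. if j = i then n j - k else n j)"
    "of_int k = 2 * (lat n \<bullet> \<alpha> i) / (\<alpha> i \<bullet> \<alpha> i)"
proof -
  obtain k :: int where k: "r i (lat n) = lat n - of_int k *\<^sub>R \<alpha> i"
    "of_int k = 2 * (lat n \<bullet> \<alpha> i) / (\<alpha> i \<bullet> \<alpha> i)"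
    using reflection_int[OF simple_root assms] by blast
  have "lat n - of_int k *\<^sub>R \<alpha> i = lat (\<lambda>j. n j - k * (if j = i then 1 else 0))"
    by (subst simple_root_lat) (simp add: lat_scale lat_diff)
  also have "(\<lambda>j. n j - k * (if j = i then 1 else 0)) = (\<lambda>j. if j = i then n j - k else n j)"
    by auto
  finally show ?thesis
    using k that[of k] by simp
qed

lemma lat_multiple_simple:
  assumes "lat n \<in> \<Phi>" "\<And>j. j \<noteq> i \<Longrightarrow> n j = 0"
  shows "lat n = \<alpha> i \<or> lat n = - \<alpha> i"
proof -
  have "n = (\<lambda>j. n i * (if j = i then 1 else 0))"
    using assms(2) by auto
  then have eq: "lat n = of_int (n i) *\<^sub>R \<alpha> i"
    by (subst simple_root_lat) (simp only: lat_scale)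
  then have "real_of_int (n i) = 1 \<or> real_of_int (n i) = -1"
    using reduced[of "\<alpha> i" "of_int (n i)"] assms(1) by simp
  then show ?thesis
    using eq by (metis scaleR_minus1_left scaleR_one)
qed

text \<open>The reflection changes coordinate \<open>i\<close> alone. If the image were negative,
  every other coordinate would be both nonnegative and nonpositive, hence zero, and reducedness
  would force the root to be \<open>\<alpha> i\<close> or its negative.\<close>

lemma simple_reflection_pos:
  assumes "\<beta> \<in> P" "\<beta> \<noteq> \<alpha> i"
  shows "r i \<beta> \<in> P"
proof (rule ccontr)
  assume "r i \<beta> \<notin> P"
  moreover have root: "r i \<beta> \<in> \<Phi>"
    using assms pos_root_root reflection_root by simp
  ultimately have neg: "- r i \<beta> \<in> P"
    by (simp add: pos_neg_iff)
  obtain n where n: "\<forall>j. n j \<ge> 0" "\<beta> = lat n"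
    using assms pos_root_iff by blast
  obtain k where k: "r i (lat n) = lat (\<lambda>j. if j = i then n j - k else n j)"
    using simple_reflection_lat assms n pos_root_root by metis
  obtain m where m: "\<forall>j. m j \<ge> 0" "- r i \<beta> = lat m"
    using neg pos_root_iff by blast
  have "m = (\<lambda>j. - (if j = i then n j - k else n j))"
    using m(2) unfolding n(2) k lat_uminus by simp
  note m_eq = this
  have n0: "n j = 0" if "j \<noteq> i" for j
  proof -
    have "m j = - n j"
      using that by (simp add: m_eq)
    then show ?thesis
      using m(1) n(1) by (metis neg_0_le_iff_le order_antisym)
  qed
  have "lat n \<in> \<Phi>"
    using assms(1) n(2) pos_root_root by simp
  then have "\<beta> = \<alpha> i \<or> \<beta> = - \<alpha> i"
    unfolding n(2) using n0 by (rule lat_multiple_simple)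
  then show False
    using assms not_pos_neg[of "\<alpha> i"] by auto
qed

text \<open>The reflection in \<gamma> negates \<beta>, so \<beta> is a multiple of \<gamma>, and
  reducedness leaves only the sign. This lets covers be indexed by positive roots without
  repetition.\<close>

lemma reflection_eq_imp_eq:
  assumes "\<beta> \<in> P" "\<gamma> \<in> P" "reflection \<beta> = reflection \<gamma>"
  shows "\<beta> = \<gamma>"
proof -
  obtain k :: int where "reflection \<gamma> \<beta> = \<beta> - of_int k *\<^sub>R \<gamma>"
    using reflection_int assms pos_root_root by metis
  then have "- \<beta> = \<beta> - of_int k *\<^sub>R \<gamma>"
    using assms(3) reflection_self[of \<beta>] by simp
  then have "2 *\<^sub>R \<beta> = of_int k *\<^sub>R \<gamma>"
    by (simp add: scaleR_2 algebra_simps)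
  then have "(1 / 2) *\<^sub>R (2 *\<^sub>R \<beta>) = (1 / 2) *\<^sub>R (of_int k *\<^sub>R \<gamma>)"
    by simp
  then have eq: "\<beta> = (of_int k / 2) *\<^sub>R \<gamma>"
    by simp
  then have "of_int k / 2 = (1::real) \<or> of_int k / 2 = (-1::real)"
    using reduced[of \<gamma> "of_int k / 2"] assms pos_root_root by simp
  then show ?thesis
    using eq assms not_pos_neg by (metis scaleR_minus1_left scaleR_one)
qed

subsection \<open>Length and the exchange property\<close>

primrec word :: "'i list \<Rightarrow> 'v \<Rightarrow> 'v"
  where "word [] = id" | "word (i # is) = r i \<circ> word is"

lemma word_foldr: "word is = foldr (\<lambda>i x. r i \<circ> x) is id"
  by (induction "is") auto

lemma word_append: "word (is @ js) = word is \<circ> word js"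
  by (induction "is") (auto simp: comp_assoc)

lemma word_in_weyl: "word is \<in> W"
proof (induction "is")
  case Nil
  show ?case
    unfolding word.simps by (rule weyl_id)
next
  case (Cons i "is")
  then show ?case
    unfolding word.simps by (rule weyl_reflection) simp
qed

lemma word_inverse: "word (rev is) \<circ> word is = id" "word is \<circ> word (rev is) = id"
  by (induction "is") (simp_all add: word_append fun_eq_iff)

text \<open>Descent on the height: the positive norm is the sum of
  \<open>n i * (lat n \<bullet> \<alpha> i)\<close>, so some simple root has both a positive
  coordinate and a positive inner product. Reflecting in it lowers the height, and the result stays
  positive unless the root was that simple root.\<close>

lemma pos_root_simple_conj: "\<beta> \<in> P \<Longrightarrow> \<exists>is i. \<beta> = word is (\<alpha> i)"
proof -
  have "lat n \<in> \<Phi> \<Longrightarrow> \<forall>i. n i \<ge> 0 \<Longrightarrow> \<exists>is i. lat n = word is (\<alpha> i)" for n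
  proof (induction "nat (\<Sum>i\<in>UNIV. n i)" arbitrary: n rule: less_induct)
    case less
    have "lat n \<bullet> lat n > 0"
      using less.prems zero_not_root by auto
    then have "(\<Sum>i\<in>UNIV. of_int (n i) * (lat n \<bullet> \<alpha> i)) > 0"
      by (metis (no_types, lifting) inner_scaleR_right inner_sum_right lat_def sum.cong)
    then obtain i where "of_int (n i) * (lat n \<bullet> \<alpha> i) > 0"
      using sum_nonpos[of UNIV "\<lambda>i. of_int (n i) * (lat n \<bullet> \<alpha> i)"] by (meson linorder_not_le)
    then have i: "lat n \<bullet> \<alpha> i > 0" "n i > 0"
      using less.prems(2)[rule_format, of i] by (auto simp: zero_less_mult_iff)
    show ?case
    proof (cases "lat n = \<alpha> i")
      case True
      then show ?thesis
        by (intro exI[of _ "[]"]) auto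
    next
      case False
      obtain k where k: "r i (lat n) = lat (\<lambda>j. if j = i then n j - k else n j)"
        "of_int k = 2 * (lat n \<bullet> \<alpha> i) / (\<alpha> i \<bullet> \<alpha> i)"
        by (rule simple_reflection_lat[OF less.prems(1)])
      let ?m = "\<lambda>j. if j = i then n j - k else n j"
      have "\<alpha> i \<bullet> \<alpha> i > 0"
        using simple_root zero_not_root by (metis inner_gt_zero_iff)
      then have "real_of_int k > 0"
        using k(2) i(1) by simp
      then have "k > 0"
        by simp
      have "r i (lat n) \<in> P"
        using less.prems False by (intro simple_reflection_pos) (auto simp: pos_root_iff)
      then have m: "lat ?m \<in> \<Phi>" "\<forall>j. ?m j \<ge> 0"
        unfolding k by (auto simp: pos_root_iff)
      have "(\<Sum>j\<in>UNIV. ?m j) < (\<Sum>j\<in>UNIV. n j)"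
        using \<open>k > 0\<close> by (intro sum_strict_mono_ex1) auto
      moreover have "(\<Sum>j\<in>UNIV. ?m j) \<ge> 0"
        using m by (intro sum_nonneg) auto
      ultimately have "nat (\<Sum>j\<in>UNIV. ?m j) < nat (\<Sum>j\<in>UNIV. n j)"
        by simp
      then obtain "is" j where "lat ?m = word is (\<alpha> j)"
        using less.hyps m by blast
      then have "lat n = word (i # is) (\<alpha> j)"
        using k(1) by (metis comp_apply word.simps(2) reflection_involutive)
      then show ?thesis
        by blast
    qed
  qed
  moreover assume "\<beta> \<in> P"
  ultimately show ?thesis
    unfolding pos_root_iff by blast
qed

lemma root_conj_simple:
  assumes "\<beta> \<in> \<Phi>"
  obtains w i where "w \<in> W" "\<beta> = w (\<alpha> i)"
proof -
  obtain "is" i where "\<beta> = word is (\<alpha> i) \<or> - \<beta> = word is (\<alpha> i)"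
    using root_cases[OF assms] pos_root_simple_conj by metis
  then show ?thesis
  proof
    assume "- \<beta> = word is (\<alpha> i)"
    then have "\<beta> = (word is \<circ> r i) (\<alpha> i)"
      using weyl_neg[OF word_in_weyl] by (simp add: reflection_self) (metis minus_minus)
    then show ?thesis
      using that weyl_comp_reflection[OF word_in_weyl] simple_root by blast
  qed (use that word_in_weyl in blast)
qed

lemma reflection_word:
  assumes "\<beta> \<in> \<Phi>"
  shows "\<exists>is. reflection \<beta> = word is"
proof -
  have pos: "\<exists>is. reflection \<gamma> = word is" if "\<gamma> \<in> P" for \<gamma>
  proof -
    obtain js i where "\<gamma> = word js (\<alpha> i)"
      using pos_root_simple_conj \<open>\<gamma> \<in> P\<close> by blast
    then have "reflection \<gamma> \<circ> word js = word js \<circ> r i"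
      by (simp add: weyl_reflection_conj[OF word_in_weyl])
    then have "reflection \<gamma> = word js \<circ> r i \<circ> word (rev js)"
      by (metis comp_assoc comp_id word_inverse(2))
    then have "reflection \<gamma> = word (js @ i # rev js)"
      by (simp only: word_append word.simps comp_assoc comp_id)
    then show ?thesis ..
  qed
  show ?thesis
    using root_cases[OF assms] pos by (metis reflection_uminus)
qed

lemma weyl_word: "w \<in> W \<Longrightarrow> \<exists>is. w = word is"
proof (induction rule: weyl.induct)
  case weyl_id
  show ?case
    by (intro exI[of _ "[]"]) auto
next
  case (weyl_reflection w \<beta>)
  then show ?case
    using reflection_word by (metis word_append)
qed

lemma len_word_le: "L (word is) \<le> length is"
  unfolding len_def word_foldr by (rule Least_le) auto

lemma reduced_word:
  assumes "w \<in> W"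
  obtains "is" where "length is = L w" "w = word is"
proof -
  have "\<exists>n is. length is = n \<and> w = word is"
    using weyl_word[OF assms] by blast
  from LeastI_ex[OF this] show ?thesis
    using that unfolding len_def word_foldr by blast
qed

text \<open>Strong exchange: \<beta> is carried through the letters from the left and stays positive
  until it meets its own simple reflection, which can then be deleted. The encounter must take
  place, since otherwise the positive root \<gamma> would be the negative of a positive
  root.\<close>

lemma word_exchange:
  assumes "\<gamma> \<in> P" "\<beta> \<in> P" "word is \<gamma> = - \<beta>"
  shows "\<exists>js. length js < length is \<and> word js = reflection \<beta> \<circ> word is"
  using assms(2,3)
proof (induction "is" arbitrary: \<beta>)
  case Nil
  then show ?case
    using assms(1) not_pos_neg by fastforce
next
  case (Cons i "is")
  show ?case
  proof (cases "\<beta> = \<alpha> i")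
    case True
    then show ?thesis
      by (intro exI[of _ "is"]) auto
  next
    case False
    have "word is \<gamma> = - r i \<beta>"
      using Cons.prems(2) by (metis comp_apply word.simps(2) reflection_involutive reflection_neg)
    then obtain js where js: "length js < length is" "word js = reflection (r i \<beta>) \<circ> word is"
      using Cons.IH[OF simple_reflection_pos[OF Cons.prems(1) False]] by blast
    have "r i \<circ> reflection (r i \<beta>) = reflection \<beta> \<circ> r i"
      using weyl_reflection_conj[OF reflection_in_weyl, of "\<alpha> i" "r i \<beta>"] by simp
    then have "word (i # js) = reflection \<beta> \<circ> word (i # is)"
      using js(2) by (simp add: comp_assoc[symmetric])
    then show ?thesis
      using js(1) by (intro exI[of _ "i # js"]) auto
  qed
qed

lemma len_reflection_less:
  assumes "w \<in> W" "\<gamma> \<in> P" "- w \<gamma> \<in> P"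
  shows "L (w \<circ> reflection \<gamma>) < L w"
proof -
  obtain "is" where "is": "length is = L w" "w = word is"
    using reduced_word assms by blast
  then obtain js where "length js < L w" "word js = reflection (- w \<gamma>) \<circ> w"
    using word_exchange[OF assms(2,3), of "is"] by auto
  then show ?thesis
    using len_word_le[of js] weyl_reflection_conj[OF assms(1)] by simp
qed

text \<open>This is the previous inequality for \<open>w \<circ> reflection \<gamma>\<close>, which
  sends \<gamma> to \<open>- w \<gamma>\<close>.\<close>

lemma len_reflection_greater:
  assumes "w \<in> W" "\<gamma> \<in> P" "w \<gamma> \<in> P"
  shows "L w < L (w \<circ> reflection \<gamma>)"
  using len_reflection_less[of "w \<circ> reflection \<gamma>" \<gamma>] assms
  by (simp add: weyl_comp_reflection pos_root_root reflection_self weyl_neg)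

lemma len_reflection_less_iff:
  "w \<in> W \<Longrightarrow> \<gamma> \<in> P \<Longrightarrow> L (w \<circ> reflection \<gamma>) < L w \<longleftrightarrow> w \<gamma> \<notin> P"
  using len_reflection_less[of w \<gamma>] len_reflection_greater[of w \<gamma>]
    pos_neg_iff[OF weyl_root[OF _ pos_root_root]] by fastforce

lemma len_reflection_greater_iff:
  "w \<in> W \<Longrightarrow> \<gamma> \<in> P \<Longrightarrow> L w < L (w \<circ> reflection \<gamma>) \<longleftrightarrow> w \<gamma> \<in> P"
  using len_reflection_less[of w \<gamma>] len_reflection_greater[of w \<gamma>]
    pos_neg_iff[OF weyl_root[OF _ pos_root_root]] by fastforce

lemma len_simple_le: "w \<in> W \<Longrightarrow> L (w \<circ> r i) \<le> Suc (L w)"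
proof -
  assume "w \<in> W"
  then obtain "is" where "is": "length is = L w" "w = word is"
    using reduced_word by blast
  then have "w \<circ> r i = word (is @ [i])"
    by (simp add: word_append)
  then show ?thesis
    using len_word_le[of "is @ [i]"] "is" by simp
qed

lemma len_simple_up: "w \<in> W \<Longrightarrow> w (\<alpha> i) \<in> P \<Longrightarrow> L (w \<circ> r i) = Suc (L w)"
  using len_reflection_greater[of w "\<alpha> i"] len_simple_le[of w i] by simp

lemma len_simple_down:
  assumes "w \<in> W" "w (\<alpha> i) \<notin> P"
  shows "L w = Suc (L (w \<circ> r i))"
  using len_simple_up[of "w \<circ> r i" i] assms
  by (simp add: weyl_comp_reflection reflection_self weyl_neg pos_neg_iff weyl_root)

text \<open>The last letter of a reduced word is a right descent.\<close>

lemma exists_descent: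
  assumes "w \<in> W" "L w > 0"
  obtains i where "w (\<alpha> i) \<notin> P"
proof -
  obtain "is" where "is": "length is = L w" "w = word is"
    using reduced_word assms by blast
  then obtain js i where "is = js @ [i]"
    using assms by (metis length_0_conv less_numeral_extra(3) rev_exhaust)
  then have "w \<circ> r i = word js" "length js < L w"
    using "is" by (simp_all add: word_append)
  then have "L (w \<circ> r i) < L w"
    using len_word_le[of js] by simp
  then show ?thesis
    using len_reflection_less_iff[of w "\<alpha> i"] assms that by simp
qed

text \<open>A Weyl group element is linear and the simple roots span, so it is determined by their
  images, which lie in the finite set \<Phi>. Finiteness makes the sums over \<open>W\<close>
  meaningful.\<close>

lemma finite_weyl: "finite W"
proof (rule finite_imageD)
  show "finite ((\<lambda>w i. w (\<alpha> i)) ` W)"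
  proof (rule finite_subset)
    show "(\<lambda>w i. w (\<alpha> i)) ` W \<subseteq> (UNIV :: 'i set) \<rightarrow>\<^sub>E \<Phi>"
      using weyl_root by auto
    show "finite ((UNIV :: 'i set) \<rightarrow>\<^sub>E \<Phi>)"
      using finite_roots by (intro finite_PiE) auto
  qed
  show "inj_on (\<lambda>w i. w (\<alpha> i)) W"
  proof (rule inj_onI)
    fix x y
    assume xy: "x \<in> W" "y \<in> W" "(\<lambda>i. x (\<alpha> i)) = (\<lambda>i. y (\<alpha> i))"
    have "lat n \<in> span (range \<alpha>)" for n
      unfolding lat_def by (intro span_sum span_scale span_base) auto
    then have "\<Phi> \<subseteq> span (range \<alpha>)"
      using root_lat by blast
    then have "span (range \<alpha>) = UNIV"
      using span_roots by (metis span_minimal subspace_span top.extremum_uniqueI)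
    moreover have "x v = y v" if "v \<in> range \<alpha>" for v
      using xy(3) that by (auto simp: fun_eq_iff)
    ultimately show "x = y"
      using linear_eq_on_span[OF weyl_linear[OF xy(1)] weyl_linear[OF xy(2)]]
      by (auto simp: fun_eq_iff)
  qed
qed

lemma bruhat_less_len: "bruhat_less \<Phi> \<alpha> x y \<Longrightarrow> L x < L y"
  unfolding bruhat_less_def by (induction rule: tranclp_induct) auto

text \<open>Every Bruhat chain increases length, and a single length-increasing reflection already
  is a chain. Comparisons along one reflection are therefore decided by length.\<close>

lemma bruhat_less_reflection_iff:
  assumes "w \<in> W" "\<beta> \<in> \<Phi>"
  shows "bruhat_less \<Phi> \<alpha> (w \<circ> reflection \<beta>) w \<longleftrightarrow> L (w \<circ> reflection \<beta>) < L w"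
    and "bruhat_less \<Phi> \<alpha> w (w \<circ> reflection \<beta>) \<longleftrightarrow> L w < L (w \<circ> reflection \<beta>)"
    and "bruhat_less \<Phi> \<alpha> (reflection \<beta> \<circ> w) w \<longleftrightarrow> L (reflection \<beta> \<circ> w) < L w"
proof -
  have less: "bruhat_less \<Phi> \<alpha> x y" if "x \<in> W" "\<gamma> \<in> \<Phi>" "y = reflection \<gamma> \<circ> x" "L x < L y" for x y \<gamma>
    unfolding bruhat_less_def using that by (intro tranclp.r_into_trancl) auto
  have conj: "w \<circ> reflection \<beta> = reflection (w \<beta>) \<circ> w"
    using weyl_reflection_conj assms by blast
  show "bruhat_less \<Phi> \<alpha> (w \<circ> reflection \<beta>) w \<longleftrightarrow> L (w \<circ> reflection \<beta>) < L w"
    using less[of "w \<circ> reflection \<beta>" "w \<beta>" w] assms bruhat_less_len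
    by (auto simp: conj weyl_root weyl.intros)
  show "bruhat_less \<Phi> \<alpha> w (w \<circ> reflection \<beta>) \<longleftrightarrow> L w < L (w \<circ> reflection \<beta>)"
    using less[of w "w \<beta>" "w \<circ> reflection \<beta>"] assms bruhat_less_len
    by (auto simp: conj weyl_root weyl.intros)
  show "bruhat_less \<Phi> \<alpha> (reflection \<beta> \<circ> w) w \<longleftrightarrow> L (reflection \<beta> \<circ> w) < L w"
    using less[of "reflection \<beta> \<circ> w" \<beta> w] assms bruhat_less_len
    by (auto simp: weyl.intros)
qed

subsection \<open>Inversions\<close>

text \<open>The positive roots made negative by the inverse of \<open>w\<close>, written without the
  inverse. They index the product that prescribes the value of the Schubert class of
  \<open>w\<close> at \<open>w\<close>.\<close>

definition invs :: "('v \<Rightarrow> 'v) \<Rightarrow> 'v set"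
  where "invs w = {\<beta>\<in>P. \<exists>\<gamma>\<in>P. w \<gamma> = - \<beta>}"

lemma finite_invs: "finite (invs w)"
  using finite_pos_roots by (simp add: invs_def)

lemma invs_pos: "\<beta> \<in> invs w \<Longrightarrow> \<beta> \<in> P"
  by (simp add: invs_def)

lemma inv_root_cases:
  assumes "w \<in> W" "\<beta> \<in> P"
  obtains \<gamma> where "\<gamma> \<in> P" "w \<gamma> = \<beta>" | \<gamma> where "\<gamma> \<in> P" "w \<gamma> = - \<beta>"
proof -
  obtain z where z: "z \<in> W" "\<And>x. w (z x) = x" "\<And>x. z (w x) = x"
    using weyl_inverse assms by blast
  have "z \<beta> \<in> \<Phi>"
    using z assms weyl_root pos_root_root by blast
  then show ?thesis
    using root_cases[of "z \<beta>"] that z(2) weyl_neg[OF assms(1), of "z \<beta>"] by metis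
qed

text \<open>Pulling \<beta> back through \<open>w\<close> gives a root that is positive up to sign,
  and the left reflection in \<beta> becomes a right reflection in it.\<close>

lemma reflection_len_less_iff:
  assumes "w \<in> W" "\<beta> \<in> P"
  shows "L (reflection \<beta> \<circ> w) < L w \<longleftrightarrow> \<beta> \<in> invs w"
  using assms
proof (cases rule: inv_root_cases)
  case (1 \<gamma>)
  then have "\<beta> \<notin> invs w"
    using assms weyl_inj[OF assms(1)] weyl_neg[OF assms(1)] not_pos_neg
    unfolding invs_def by (smt (verit) mem_Collect_eq minus_minus)
  moreover have "reflection \<beta> \<circ> w = w \<circ> reflection \<gamma>"
    using 1 weyl_reflection_conj[OF assms(1), of \<gamma>] by simp
  ultimately show ?thesis
    using 1 len_reflection_less_iff[OF assms(1), of \<gamma>] assms by simp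
next
  case (2 \<gamma>)
  then have "\<beta> \<in> invs w"
    using assms by (auto simp: invs_def)
  moreover have "reflection \<beta> \<circ> w = w \<circ> reflection \<gamma>"
    using 2 weyl_reflection_conj[OF assms(1), of \<gamma>] by simp
  ultimately show ?thesis
    using 2 len_reflection_less_iff[OF assms(1), of \<gamma>] assms not_pos_neg by auto
qed

lemma schubert_roots_eq_invs:
  "w \<in> W \<Longrightarrow> {\<beta>. \<beta> \<in> P \<and> bruhat_less \<Phi> \<alpha> (reflection \<beta> \<circ> w) w} = invs w"
  using reflection_len_less_iff bruhat_less_reflection_iff(3) pos_root_root invs_pos by blast

text \<open>The simple reflection permutes the positive roots other than \<open>\<alpha> i\<close>,
  so the only new inversion comes from \<open>\<alpha> i\<close> itself.\<close>

lemma invs_simple_up: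
  assumes w: "w \<in> W" and up: "w (\<alpha> i) \<in> P"
  shows "invs (w \<circ> r i) = insert (w (\<alpha> i)) (invs w)" and "w (\<alpha> i) \<notin> invs w"
proof -
  show "w (\<alpha> i) \<notin> invs w"
  proof
    assume "w (\<alpha> i) \<in> invs w"
    then obtain \<gamma> where "\<gamma> \<in> P" "w \<gamma> = w (- \<alpha> i)"
      using w weyl_neg by (auto simp: invs_def)
    then show False
      using w weyl_inj not_pos_neg[of "\<alpha> i"] by auto
  qed
  have conv: "(\<exists>\<gamma>\<in>P. w (r i \<gamma>) = - \<beta>) \<longleftrightarrow> \<beta> = w (\<alpha> i) \<or> (\<exists>\<gamma>\<in>P. w \<gamma> = - \<beta>)" if "\<beta> \<in> P" for \<beta>
  proof
    assume "\<exists>\<gamma>\<in>P. w (r i \<gamma>) = - \<beta>"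
    then obtain \<gamma> where \<gamma>: "\<gamma> \<in> P" "w (r i \<gamma>) = - \<beta>"
      by blast
    then show "\<beta> = w (\<alpha> i) \<or> (\<exists>\<gamma>\<in>P. w \<gamma> = - \<beta>)"
      using simple_reflection_pos[of \<gamma> i] w
      by (cases "\<gamma> = \<alpha> i") (auto simp: reflection_self weyl_neg)
  next
    assume "\<beta> = w (\<alpha> i) \<or> (\<exists>\<gamma>\<in>P. w \<gamma> = - \<beta>)"
    then show "\<exists>\<gamma>\<in>P. w (r i \<gamma>) = - \<beta>"
    proof
      assume "\<beta> = w (\<alpha> i)"
      then show ?thesis
        using w by (intro bexI[of _ "\<alpha> i"]) (auto simp: reflection_self weyl_neg)
    next
      assume "\<exists>\<gamma>\<in>P. w \<gamma> = - \<beta>"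
      then obtain \<gamma> where \<gamma>: "\<gamma> \<in> P" "w \<gamma> = - \<beta>"
        by blast
      then have "\<gamma> \<noteq> \<alpha> i"
        using up that not_pos_neg by auto
      then show ?thesis
        using \<gamma> simple_reflection_pos by (intro bexI[of _ "r i \<gamma>"]) auto
    qed
  qed
  then show "invs (w \<circ> r i) = insert (w (\<alpha> i)) (invs w)"
    using up by (auto simp: invs_def)
qed

text \<open>Right descents remove inversions one at a time. The count ensures that the value
  prescribed at \<open>w\<close> has degree \<open>L w\<close>.\<close>

lemma card_invs: "w \<in> W \<Longrightarrow> card (invs w) = L w"
proof (induction "L w" arbitrary: w)
  case 0
  then obtain "is" where "length is = L w" "w = word is"
    using reduced_word by blast
  then have "w = id"
    using 0 by simp
  then have "invs w = {}"
    using not_pos_neg by (auto simp: invs_def)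
  then show ?case
    using 0 by simp
next
  case (Suc n)
  then obtain i where i: "w (\<alpha> i) \<notin> P"
    using exists_descent by (metis zero_less_Suc)
  define v where "v = w \<circ> r i"
  have v: "v \<in> W" "v (\<alpha> i) \<in> P"
    using Suc.prems i
    by (auto simp: v_def weyl_comp_reflection reflection_self weyl_neg pos_neg_iff weyl_root)
  have w: "w = v \<circ> r i"
    by (simp only: v_def reflection_comp_self_right)
  have "L w = Suc (L v)"
    unfolding v_def using len_simple_down Suc.prems i by blast
  moreover have "card (invs w) = Suc (card (invs v))"
    unfolding w invs_simple_up(1)[OF v]
    using invs_simple_up(2)[OF v] finite_invs[of v] by simp
  ultimately show ?case
    using Suc.hyps(1)[of v] Suc.hyps(2) v by simp
qed

text \<open>Positive roots are nonnegative combinations of simple roots, all of which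
  \<open>w\<close> negates. Such a \<open>w\<close> is the longest element, from which the Schubert
  classes are built.\<close>

lemma invs_all_down:
  assumes "w \<in> W" "\<And>i. w (\<alpha> i) \<notin> P"
  shows "invs w = P"
proof -
  have "- w (\<alpha> i) \<in> P" for i
    using assms(2) pos_neg_iff[OF weyl_root[OF assms(1) simple_root]] by simp
  then have "\<forall>i. \<exists>n. (\<forall>j. n j \<ge> 0) \<and> - w (\<alpha> i) = lat n"
    by (simp add: pos_root_iff)
  from choice[OF this] obtain N where N: "\<And>i j. N i j \<ge> 0" "\<And>i. - w (\<alpha> i) = lat (N i)"
    by blast
  have neg: "w \<gamma> \<notin> P" if "\<gamma> \<in> P" for \<gamma>
  proof -
    obtain n where n: "\<forall>i. n i \<ge> 0" "\<gamma> = lat n"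
      using \<open>\<gamma> \<in> P\<close> unfolding pos_root_iff by (elim conjE exE) (rule that)
    have "w (\<alpha> i) = lat (\<lambda>j. - N i j)" for i
      by (simp flip: lat_uminus N(2))
    then have "w \<gamma> = lat (\<lambda>j. \<Sum>i\<in>UNIV. n i * - N i j)"
      unfolding n(2) by (rule weyl_lat[OF assms(1)])
    then have "- w \<gamma> = lat (\<lambda>j. \<Sum>i\<in>UNIV. n i * N i j)"
      by (simp add: lat_uminus sum_negf)
    moreover have "- w \<gamma> \<in> \<Phi>"
      using \<open>\<gamma> \<in> P\<close> assms(1) by (simp add: root_uminus weyl_root pos_root_root)
    moreover have "(\<Sum>i\<in>UNIV. n i * N i j) \<ge> 0" for j
      using n(1) N(1) by (simp add: sum_nonneg)
    ultimately have "- w \<gamma> \<in> P"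
      unfolding pos_root_iff by (intro conjI exI[of _ "\<lambda>j. \<Sum>i\<in>UNIV. n i * N i j"] allI)
    then show ?thesis
      using not_pos_neg by fastforce
  qed
  show ?thesis
  proof
    show "P \<subseteq> invs w"
    proof
      fix \<beta>
      assume "\<beta> \<in> P"
      with assms(1) show "\<beta> \<in> invs w"
        by (cases rule: inv_root_cases) (use neg \<open>\<beta> \<in> P\<close> in \<open>auto simp: invs_def\<close>)
    qed
  qed (auto simp: invs_def)
qed

subsection \<open>Roots as linear forms\<close>

lemma root_coeff_lat: "root_coeff \<alpha> (lat n) = n"
  unfolding root_coeff_def
proof (rule the_equality)
  show "m = n" if "lat n = (\<Sum>i\<in>UNIV. of_int (m i) *\<^sub>R \<alpha> i)" for m
    using that unfolding lat_def[of m, symmetric] by simp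
qed (simp add: lat_def)

lemma root_poly_lat: "root_poly \<alpha> (lat n) = (\<Sum>i\<in>UNIV. of_int (n i) * Var i)"
  by (simp add: root_poly_def root_coeff_lat)

lemma root_poly_simple [simp]: "root_poly \<alpha> (\<alpha> i) = Var i"
proof -
  have "root_poly \<alpha> (\<alpha> i) = (\<Sum>j\<in>UNIV. of_int (if j = i then 1 else 0) * Var j)"
    by (subst simple_root_lat) (rule root_poly_lat)
  also have "\<dots> = (\<Sum>j\<in>UNIV. if j = i then Var j else 0)"
    by (rule sum.cong) auto
  finally show ?thesis
    by simp
qed

lemma root_poly_uminus: "\<beta> \<in> \<Phi> \<Longrightarrow> root_poly \<alpha> (- \<beta>) = - root_poly \<alpha> \<beta>"
  using root_lat[of \<beta>] by (auto simp: lat_uminus root_poly_lat sum_negf)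

lemma root_poly_diff_scale:
  assumes "\<beta> \<in> \<Phi>" "\<gamma> \<in> \<Phi>"
  shows "root_poly \<alpha> (\<beta> - of_int k *\<^sub>R \<gamma>) = root_poly \<alpha> \<beta> - of_int k * root_poly \<alpha> \<gamma>"
proof -
  obtain n m where nm: "\<beta> = lat n" "\<gamma> = lat m"
    using root_lat assms by metis
  show ?thesis
    unfolding nm lat_scale lat_diff root_poly_lat
    by (simp add: sum_distrib_left sum_subtractf algebra_simps)
qed

lemma homogeneous_root_poly: "homogeneous 1 (root_poly \<alpha> x)"
  unfolding root_poly_def by (intro homogeneous_sum homogeneous_of_int_mult homogeneous_Var)

lemma root_poly_nonzero: "\<beta> \<in> \<Phi> \<Longrightarrow> root_poly \<alpha> \<beta> \<noteq> 0"
proof -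
  assume "\<beta> \<in> \<Phi>"
  then obtain n where n: "\<beta> = lat n"
    using root_lat by blast
  then have "lat n \<noteq> 0"
    using \<open>\<beta> \<in> \<Phi>\<close> zero_not_root by metis
  then show ?thesis
    by (simp add: n root_poly_lat linear_form_eq_0_iff lat_eq_0_iff)
qed

lemma act_root_poly:
  assumes "w \<in> W" "\<beta> \<in> \<Phi>"
  shows "act \<alpha> w (root_poly \<alpha> \<beta>) = root_poly \<alpha> (w \<beta>)"
proof -
  obtain n where n: "\<beta> = lat n"
    using root_lat assms by blast
  have "\<forall>i. \<exists>m. w (\<alpha> i) = lat m"
    using root_lat weyl_root assms(1) by simp
  from choice[OF this] obtain N where N: "\<And>i. w (\<alpha> i) = lat (N i)"
    by blast
  have "root_poly \<alpha> (w \<beta>) = (\<Sum>j\<in>UNIV. \<Sum>i\<in>UNIV. of_int (n i * N i j) * Var j)"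
    unfolding n weyl_lat[OF assms(1) N]
    by (simp only: root_poly_lat of_int_sum sum_distrib_right)
  also have "\<dots> = (\<Sum>i\<in>UNIV. \<Sum>j\<in>UNIV. of_int (n i * N i j) * Var j)"
    by (rule sum.swap)
  also have "\<dots> = (\<Sum>i\<in>UNIV. of_int (n i) * root_poly \<alpha> (w (\<alpha> i)))"
    by (simp add: N root_poly_lat sum_distrib_left mult.assoc)
  also have "\<dots> = act \<alpha> w (root_poly \<alpha> \<beta>)"
    by (simp add: n root_poly_lat act_eq_subst subst_sum subst_mult subst_of_int)
  finally show ?thesis ..
qed

lemma act_inverse:
  assumes "w \<in> W" "z \<in> W" "\<And>x. w (z x) = x"
  shows "act \<alpha> w (act \<alpha> z f) = f"
proof -
  have "act \<alpha> w (act \<alpha> z f) = subst (\<lambda>i. act \<alpha> w (root_poly \<alpha> (z (\<alpha> i)))) f"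
    by (simp only: act_eq_subst subst_subst)
  also have "\<dots> = subst Var f"
    using assms by (simp add: act_root_poly weyl_root)
  finally show ?thesis
    by (simp add: subst_Var_id)
qed

section \<open>Roots as pairwise non-associated primes of \<open>H\<close>\<close>

lemma root_poly_dvd_iff_Var_dvd:
  assumes "w \<in> W" "z \<in> W" "\<And>x. w (z x) = x" "\<And>x. z (w x) = x"
  shows "root_poly \<alpha> (w (\<alpha> i)) dvd f \<longleftrightarrow> Var i dvd act \<alpha> z f"
proof
  assume "root_poly \<alpha> (w (\<alpha> i)) dvd f"
  then obtain h where "f = root_poly \<alpha> (w (\<alpha> i)) * h"
    by blast
  then have "act \<alpha> z f = act \<alpha> z (root_poly \<alpha> (w (\<alpha> i))) * act \<alpha> z h"
    by (simp add: act_eq_subst subst_mult)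
  then show "Var i dvd act \<alpha> z f"
    using assms by (simp add: act_root_poly weyl_root)
next
  assume "Var i dvd act \<alpha> z f"
  then obtain h where "act \<alpha> z f = Var i * h"
    by blast
  then have "act \<alpha> w (act \<alpha> z f) = root_poly \<alpha> (w (\<alpha> i)) * act \<alpha> w h"
    by (simp add: act_eq_subst subst_mult)
  then show "root_poly \<alpha> (w (\<alpha> i)) dvd f"
    using act_inverse[OF assms(1-3)] by simp
qed

text \<open>A Weyl group element carrying a simple root to \<beta> induces an automorphism of
  \<open>H\<close>, which transports primality from a variable.\<close>

lemma root_poly_prime:
  assumes "\<beta> \<in> \<Phi>" "root_poly \<alpha> \<beta> dvd f * g"
  shows "root_poly \<alpha> \<beta> dvd f \<or> root_poly \<alpha> \<beta> dvd g"
proof -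
  obtain w i where w: "w \<in> W" "\<beta> = w (\<alpha> i)"
    using root_conj_simple assms by blast
  obtain z where z: "z \<in> W" "\<And>x. w (z x) = x" "\<And>x. z (w x) = x"
    using weyl_inverse w by blast
  have "Var i dvd act \<alpha> z f * act \<alpha> z g"
    using assms(2) root_poly_dvd_iff_Var_dvd[OF w(1) z, of i "f * g"]
    by (simp add: w(2) act_eq_subst subst_mult)
  then show ?thesis
    using Var_dvd_mult root_poly_dvd_iff_Var_dvd[OF w(1) z] w(2) by metis
qed

text \<open>After moving \<beta> to a simple root, divisibility by the variable kills all other
  coordinates of the second root; reducedness then fixes it up to sign.\<close>

lemma root_poly_dvd_root_poly:
  assumes "\<beta> \<in> \<Phi>" "\<gamma> \<in> \<Phi>" "root_poly \<alpha> \<beta> dvd root_poly \<alpha> \<gamma>"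
  shows "\<gamma> = \<beta> \<or> \<gamma> = - \<beta>"
proof -
  obtain w i where w: "w \<in> W" "\<beta> = w (\<alpha> i)"
    using root_conj_simple assms by blast
  obtain z where z: "z \<in> W" "\<And>x. w (z x) = x" "\<And>x. z (w x) = x"
    using weyl_inverse w by blast
  have z\<gamma>: "z \<gamma> \<in> \<Phi>"
    using z assms weyl_root by blast
  then obtain n where n: "z \<gamma> = lat n"
    using root_lat by blast
  have "Var i dvd root_poly \<alpha> (z \<gamma>)"
    using assms(2,3) root_poly_dvd_iff_Var_dvd[OF w(1) z] z by (simp add: w(2) act_root_poly)
  then have "0 = (\<Sum>j\<in>UNIV. of_int (n j) * (if j = i then 0 else Var j :: 'i H))"
    by (simp add: n root_poly_lat Var_dvd_iff subst_sum subst_mult subst_of_int)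
  also have "\<dots> = (\<Sum>j\<in>UNIV. of_int (if j = i then 0 else n j) * Var j)"
    by (rule sum.cong) auto
  finally have "\<forall>j. (if j = i then 0 else n j) = 0"
    unfolding eq_commute[of 0] linear_form_eq_0_iff .
  then have "n j = 0" if "j \<noteq> i" for j
    using that by (auto dest: spec[of _ j])
  then have "z \<gamma> = \<alpha> i \<or> z \<gamma> = - \<alpha> i"
    using z\<gamma> unfolding n by (intro lat_multiple_simple)
  then show ?thesis
    using z(2)[of \<gamma>] w weyl_neg by metis
qed

text \<open>The factors are split off one at a time: a new prime root divides the product found so
  far times a cofactor but none of the earlier factors, so it divides the cofactor.\<close>

lemma prod_root_poly_dvd:
  assumes "A \<subseteq> P" "\<And>\<beta>. \<beta> \<in> A \<Longrightarrow> root_poly \<alpha> \<beta> dvd f"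
  shows "(\<Prod>\<beta>\<in>A. root_poly \<alpha> \<beta>) dvd f"
proof -
  have "finite A"
    using assms(1) finite_pos_roots finite_subset by blast
  then show ?thesis
    using assms
  proof (induction A)
    case (insert \<beta> A)
    have \<beta>: "\<beta> \<in> \<Phi>"
      using insert.prems pos_root_root by blast
    obtain g where g: "f = (\<Prod>\<gamma>\<in>A. root_poly \<alpha> \<gamma>) * g"
      using insert by auto
    have "\<not> root_poly \<alpha> \<beta> dvd (\<Prod>\<gamma>\<in>B. root_poly \<alpha> \<gamma>)" if "finite B" "B \<subseteq> A" for B
      using that
    proof (induction B)
      \<comment> \<open>A root is not a unit, because it has degree 1 and the constant 1 has degree
        0.\<close>
      case empty
      show ?case
      proof
        assume "root_poly \<alpha> \<beta> dvd (\<Prod>\<gamma>\<in>{}. root_poly \<alpha> \<gamma>)"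
        then have "(1 :: 'i H) = 0"
          using homogeneous_dvd_imp_0[OF homogeneous_1 homogeneous_root_poly] by simp
        then show False
          by simp
      qed
    next
      case (insert \<gamma> B)
      have "\<gamma> \<in> P" "\<gamma> \<noteq> \<beta>"
        using insert.prems \<open>insert \<beta> A \<subseteq> P\<close> \<open>\<beta> \<notin> A\<close> by auto
      then have "\<not> root_poly \<alpha> \<beta> dvd root_poly \<alpha> \<gamma>"
        using root_poly_dvd_root_poly[OF \<beta>, of \<gamma>] pos_root_root not_pos_neg[of \<beta>]
          \<open>insert \<beta> A \<subseteq> P\<close> by auto
      then show ?case
        using insert root_poly_prime[OF \<beta>] by (metis insert_subset prod.insert)
    qed
    then have "\<not> root_poly \<alpha> \<beta> dvd (\<Prod>\<gamma>\<in>A. root_poly \<alpha> \<gamma>)"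
      using \<open>finite A\<close> by blast
    moreover have "root_poly \<alpha> \<beta> dvd (\<Prod>\<gamma>\<in>A. root_poly \<alpha> \<gamma>) * g"
      using insert.prems(2) g by blast
    ultimately have "root_poly \<alpha> \<beta> dvd g"
      using root_poly_prime[OF \<beta>] by blast
    then show ?case
      using insert.hyps by (auto simp: g mult.commute intro: mult_dvd_mono)
  qed auto
qed

subsection \<open>Classes\<close>

abbreviation "gkm \<equiv> gkm_class \<Phi> \<alpha>"

definition inv_prod :: "('v \<Rightarrow> 'v) \<Rightarrow> 'i H"
  where "inv_prod w = (\<Prod>\<beta>\<in>invs w. root_poly \<alpha> \<beta>)"

lemma gkm_dvd: "gkm p \<Longrightarrow> v \<in> W \<Longrightarrow> \<beta> \<in> \<Phi> \<Longrightarrow> root_poly \<alpha> \<beta> dvd p v - p (reflection \<beta> \<circ> v)"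
  by (simp add: gkm_class_def)

lemma gkm_off: "gkm p \<Longrightarrow> v \<notin> W \<Longrightarrow> p v = 0"
  by (simp add: gkm_class_def)

lemma gkm_diff:
  assumes "gkm p" "gkm q"
  shows "gkm (\<lambda>v. p v - q v)"
proof -
  have "root_poly \<alpha> \<beta> dvd (p v - q v) - (p (reflection \<beta> \<circ> v) - q (reflection \<beta> \<circ> v))"
    if "v \<in> W" "\<beta> \<in> \<Phi>" for v \<beta>
    using dvd_diff[OF gkm_dvd[OF assms(1) that] gkm_dvd[OF assms(2) that]]
    by (simp add: algebra_simps)
  then show ?thesis
    using assms by (simp add: gkm_class_def)
qed

lemma gkm_add:
  assumes "gkm p" "gkm q"
  shows "gkm (\<lambda>v. p v + q v)"
proof -
  have "root_poly \<alpha> \<beta> dvd (p v + q v) - (p (reflection \<beta> \<circ> v) + q (reflection \<beta> \<circ> v))"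
    if "v \<in> W" "\<beta> \<in> \<Phi>" for v \<beta>
    using dvd_add[OF gkm_dvd[OF assms(1) that] gkm_dvd[OF assms(2) that]]
    by (simp add: algebra_simps)
  then show ?thesis
    using assms by (simp add: gkm_class_def)
qed

lemma gkm_mult:
  assumes "gkm p" "gkm q"
  shows "gkm (\<lambda>v. p v * q v)"
proof -
  have "root_poly \<alpha> \<beta> dvd p v * q v - p (reflection \<beta> \<circ> v) * q (reflection \<beta> \<circ> v)"
    if "v \<in> W" "\<beta> \<in> \<Phi>" for v \<beta>
  proof -
    have "p v * q v - p (reflection \<beta> \<circ> v) * q (reflection \<beta> \<circ> v) =
        (p v - p (reflection \<beta> \<circ> v)) * q v + p (reflection \<beta> \<circ> v) * (q v - q (reflection \<beta> \<circ> v))"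
      by (simp add: algebra_simps)
    then show ?thesis
      using gkm_dvd[OF assms(1) that] gkm_dvd[OF assms(2) that] by simp
  qed
  then show ?thesis
    using assms by (simp add: gkm_class_def)
qed

lemma gkm_scale:
  assumes "gkm p"
  shows "gkm (\<lambda>v. c * p v)"
proof -
  have "root_poly \<alpha> \<beta> dvd c * p v - c * p (reflection \<beta> \<circ> v)" if "v \<in> W" "\<beta> \<in> \<Phi>" for v \<beta>
    using gkm_dvd[OF assms that] by (simp flip: right_diff_distrib)
  then show ?thesis
    using assms by (simp add: gkm_class_def)
qed

lemma gkm_sum:
  assumes "\<And>a. a \<in> A \<Longrightarrow> gkm (p a)"
  shows "gkm (\<lambda>v. \<Sum>a\<in>A. p a v)"
  using assms
proof (induction A rule: infinite_finite_induct)
  case (insert a A)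
  then show ?case
    using gkm_add[of "p a" "\<lambda>v. \<Sum>a\<in>A. p a v"] by simp
qed (auto simp: gkm_class_def)

text \<open>For an inversion \<beta> of \<open>v\<close>, the point
  \<open>reflection \<beta> \<circ> v\<close> is shorter, so \<open>p\<close> vanishes there and the
  GKM condition makes \<beta> divide \<open>p v\<close>.\<close>

lemma inv_prod_dvd:
  assumes "gkm p" "v \<in> W" "\<And>u. u \<in> W \<Longrightarrow> L u < L v \<Longrightarrow> p u = 0"
  shows "inv_prod v dvd p v"
  unfolding inv_prod_def
proof (rule prod_root_poly_dvd)
  show "invs v \<subseteq> P"
    using invs_pos by blast
  fix \<beta>
  assume \<beta>: "\<beta> \<in> invs v"
  then have "L (reflection \<beta> \<circ> v) < L v" "\<beta> \<in> \<Phi>"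
    using reflection_len_less_iff assms(2) invs_pos pos_root_root by blast+
  moreover have "reflection \<beta> \<circ> v \<in> W"
    using assms(2) \<open>\<beta> \<in> \<Phi>\<close> by (rule weyl_reflection)
  ultimately have "p (reflection \<beta> \<circ> v) = 0"
    using assms(3) by blast
  then show "root_poly \<alpha> \<beta> dvd p v"
    using gkm_dvd[OF assms(1,2) \<open>\<beta> \<in> \<Phi>\<close>] by simp
qed

lemma homogeneous_inv_prod: "w \<in> W \<Longrightarrow> homogeneous (L w) (inv_prod w)"
  unfolding inv_prod_def using homogeneous_prod[of "invs w" "root_poly \<alpha>"] homogeneous_root_poly
  by (simp add: card_invs)

lemma inv_prod_nonzero: "inv_prod w \<noteq> 0"
  unfolding inv_prod_def using root_poly_nonzero invs_pos pos_root_root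
  by (intro H_prod_nonzero) blast

lemma inv_prod_up:
  assumes "w \<in> W" "w (\<alpha> i) \<in> P"
  shows "inv_prod (w \<circ> r i) = root_poly \<alpha> (w (\<alpha> i)) * inv_prod w"
  unfolding inv_prod_def invs_simple_up(1)[OF assms]
  using invs_simple_up(2)[OF assms] finite_invs by simp

text \<open>
  At a point \<open>v\<close> of minimal length in the support, \<open>L v > d\<close> distinct positive roots divide the
  value, which has degree \<open>d\<close>.
\<close>

lemma gkm_vanishing:
  assumes "gkm p" "\<And>v. v \<in> W \<Longrightarrow> homogeneous d (p v)"
    and "\<And>v. v \<in> W \<Longrightarrow> L v \<le> d \<Longrightarrow> p v = 0"
  shows "p v = 0"
proof (cases "v \<in> W")
  case True
  then show ?thesis
  proof (induction "L v" arbitrary: v rule: less_induct)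
    case less
    show ?case
    proof (cases "L v \<le> d")
      case False
      have "inv_prod v dvd p v"
        using less by (intro inv_prod_dvd assms(1)) auto
      then show ?thesis
        using homogeneous_dvd_imp_0[OF assms(2)[OF less.prems] homogeneous_inv_prod[OF less.prems]]
          False by simp
    qed (use less.prems assms(3) in blast)
  qed
qed (use assms(1) gkm_off in blast)

subsection \<open>Divided differences\<close>

text \<open>The quotient exists pointwise because \<open>v\<close> and \<open>v \<circ> r i\<close>
  differ by the left reflection in \<open>v (\<alpha> i)\<close>. The work lies in showing that the
  quotients again satisfy the GKM conditions.\<close>

lemma divided_difference:
  assumes p: "gkm p"
  shows "\<exists>q. gkm q \<and> (\<forall>v\<in>W. p (v \<circ> r i) - p v = root_poly \<alpha> (v (\<alpha> i)) * q v)"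
proof -
  have "\<exists>h. p (v \<circ> r i) - p v = root_poly \<alpha> (v (\<alpha> i)) * h" if "v \<in> W" for v
  proof -
    have "root_poly \<alpha> (v (\<alpha> i)) dvd p v - p (v \<circ> r i)"
      using gkm_dvd[OF p that weyl_root[OF that simple_root[of i]]] weyl_reflection_conj[OF that]
      by simp
    then show ?thesis
      by (metis dvd_def dvd_minus_iff minus_diff_eq)
  qed
  \<comment> \<open>The default value 0 off \<open>W\<close> is part of
    \<open>gkm_class\<close>.\<close>
  then have "\<forall>v. \<exists>h. (v \<in> W \<longrightarrow> p (v \<circ> r i) - p v = root_poly \<alpha> (v (\<alpha> i)) * h) \<and> (v \<notin> W \<longrightarrow> h = 0)"
    by blast
  from choice[OF this] obtain q
    where q: "\<And>v. v \<in> W \<Longrightarrow> p (v \<circ> r i) - p v = root_poly \<alpha> (v (\<alpha> i)) * q v"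
      and off: "\<And>v. v \<notin> W \<Longrightarrow> q v = 0"
    by blast
  have "root_poly \<alpha> \<beta> dvd q v - q (reflection \<beta> \<circ> v)" if v: "v \<in> W" and \<beta>: "\<beta> \<in> \<Phi>" for v \<beta>
  proof -
    define u where "u = reflection \<beta> \<circ> v"
    have u: "u \<in> W"
      unfolding u_def using v \<beta> by (rule weyl_reflection)
    define a where "a = root_poly \<alpha> (v (\<alpha> i))"
    define b where "b = root_poly \<alpha> (u (\<alpha> i))"
    have v\<alpha>: "v (\<alpha> i) \<in> \<Phi>"
      using v weyl_root by simp
    have u\<alpha>: "u (\<alpha> i) \<in> \<Phi>"
      using u weyl_root by simp
    note qv = q[OF v, folded a_def] and qu = q[OF u, folded b_def]
    show ?thesis
    proof (cases "v (\<alpha> i) = \<beta> \<or> v (\<alpha> i) = - \<beta>")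
      case True
      \<comment> \<open>Here the reflection merely exchanges the two points of the difference;
        numerator and denominator both change sign, so the quotients agree.\<close>
      then have eq: "u = v \<circ> r i"
        unfolding u_def weyl_reflection_conj[OF v] by auto
      then have "u \<circ> r i = v"
        by (simp only: reflection_comp_self_right)
      have "b = - a"
        unfolding a_def b_def eq by (simp add: reflection_self weyl_neg[OF v] root_poly_uminus[OF v\<alpha>])
      then have "a * q v = a * q u"
        using qv qu \<open>u \<circ> r i = v\<close> eq by (simp add: algebra_simps)
      then have "q v = q u"
        using root_poly_nonzero[OF v\<alpha>] by (simp add: a_def H_mult_left_cancel)
      then show ?thesis
        by (simp add: u_def)
    next
      case False
      obtain k :: int where "reflection \<beta> (v (\<alpha> i)) = v (\<alpha> i) - of_int k *\<^sub>R \<beta>"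
        by (rule reflection_int[OF \<beta> v\<alpha>])
      then have "u (\<alpha> i) = v (\<alpha> i) - of_int k *\<^sub>R \<beta>"
        by (simp only: u_def comp_apply)
      then have b: "b = a - of_int k * root_poly \<alpha> \<beta>"
        unfolding a_def b_def using root_poly_diff_scale[OF v\<alpha> \<beta>] by simp
      have "reflection \<beta> \<circ> (v \<circ> r i) = u \<circ> r i"
        by (simp add: u_def comp_assoc)
      then have "root_poly \<alpha> \<beta> dvd p (v \<circ> r i) - p (u \<circ> r i)"
        using gkm_dvd[OF p weyl_comp_reflection[OF v simple_root] \<beta>] by metis
      moreover have "root_poly \<alpha> \<beta> dvd p v - p u"
        unfolding u_def by (rule gkm_dvd[OF p v \<beta>])
      \<comment> \<open>Both denominators are cleared. They agree modulo \<beta>, and so do the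
        numerators, so \<beta> divides the right-hand side; as \<beta> is prime and divides neither
        denominator, it divides the difference of the quotients.\<close>
      moreover have "a * b * (q v - q u) =
          a * ((p (v \<circ> r i) - p (u \<circ> r i)) - (p v - p u))
          - root_poly \<alpha> \<beta> * (of_int k * (p (v \<circ> r i) - p v))"
      proof -
        have "a * b * (q v - q u) = b * (a * q v) - a * (b * q u)"
          by (simp add: algebra_simps)
        also have "\<dots> = b * (p (v \<circ> r i) - p v) - a * (p (u \<circ> r i) - p u)"
          by (simp only: qv qu)
        finally show ?thesis
          by (simp add: b algebra_simps)
      qed
      ultimately have "root_poly \<alpha> \<beta> dvd a * b * (q v - q u)"
        by (metis dvd_diff dvd_mult dvd_triv_left)
      moreover have "\<not> root_poly \<alpha> \<beta> dvd a"
        unfolding a_def using root_poly_dvd_root_poly[OF \<beta> v\<alpha>] False by blast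
      moreover have "\<not> root_poly \<alpha> \<beta> dvd b"
      proof
        assume "root_poly \<alpha> \<beta> dvd b"
        then have "u (\<alpha> i) = \<beta> \<or> u (\<alpha> i) = - \<beta>"
          unfolding b_def using root_poly_dvd_root_poly[OF \<beta> u\<alpha>] by blast
        then have "reflection \<beta> (u (\<alpha> i)) = - \<beta> \<or> reflection \<beta> (u (\<alpha> i)) = \<beta>"
          by (auto simp: reflection_self)
        then show False
          using False by (auto simp: u_def)
      qed
      ultimately show ?thesis
        unfolding u_def[symmetric] using root_poly_prime[OF \<beta>] by blast
    qed
  qed
  then have "gkm q"
    using off by (simp add: gkm_class_def)
  then show ?thesis
    using q by (intro exI[of _ q]) simp
qed

subsection \<open>Schubert classes\<close>

lemma is_schubert_class_iff:
  assumes "w \<in> W"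
  shows "is_schubert_class \<Phi> \<alpha> w p \<longleftrightarrow> gkm p \<and> (\<forall>v\<in>W. homogeneous (L w) (p v)) \<and>
    (\<forall>v\<in>W. L v \<le> L w \<and> v \<noteq> w \<longrightarrow> p v = 0) \<and> p w = inv_prod w"
  unfolding is_schubert_class_def inv_prod_def schubert_roots_eq_invs[OF assms] ..

lemma schubert_class_unique:
  assumes "w \<in> W" "is_schubert_class \<Phi> \<alpha> w p" "is_schubert_class \<Phi> \<alpha> w q"
  shows "p = q"
proof
  fix v
  note pq = assms(2,3)[unfolded is_schubert_class_iff[OF assms(1)]]
  have "p v - q v = 0"
  proof (rule gkm_vanishing[of "\<lambda>v. p v - q v"])
    show "gkm (\<lambda>v. p v - q v)"
      using pq gkm_diff by blast
    show "homogeneous (L w) (p v - q v)" if "v \<in> W" for v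
      using pq that homogeneous_diff by blast
    show "p v - q v = 0" if "v \<in> W" "L v \<le> L w" for v
      using pq that by (cases "v = w") auto
  qed
  then show "p v = q v"
    by simp
qed

text \<open>If \<open>v\<close> differs from \<open>w\<close> and is no longer than it, both
  \<open>v\<close> and \<open>v \<circ> r i\<close> lie where \<open>p\<close> is forced to vanish.
  At \<open>w\<close> only the value at \<open>w \<circ> r i\<close> survives, and its extra factor
  \<open>w (\<alpha> i)\<close> cancels.\<close>

lemma schubert_class_down:
  assumes w: "w \<in> W" and up: "w (\<alpha> i) \<in> P"
    and p: "is_schubert_class \<Phi> \<alpha> (w \<circ> r i) p" and q: "gkm q"
    and pq: "\<And>v. v \<in> W \<Longrightarrow> p (v \<circ> r i) - p v = root_poly \<alpha> (v (\<alpha> i)) * q v"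
  shows "is_schubert_class \<Phi> \<alpha> w q"
proof -
  have wr: "w \<circ> r i \<in> W" and len: "L (w \<circ> r i) = Suc (L w)"
    using w up by (simp_all add: weyl_comp_reflection len_simple_up)
  note p' = p[unfolded is_schubert_class_iff[OF wr] len]
  have root: "root_poly \<alpha> (v (\<alpha> i)) \<noteq> 0" if "v \<in> W" for v
    using that by (simp add: root_poly_nonzero weyl_root)
  have vr: "v \<circ> r i \<in> W" if "v \<in> W" for v
    using that by (simp add: weyl_comp_reflection)
  have "homogeneous (L w) (q v)" if v: "v \<in> W" for v
  proof (rule homogeneous_quotient)
    have "homogeneous (Suc (L w)) (p (v \<circ> r i) - p v)"
      using p' v vr homogeneous_diff by blast
    then show "homogeneous (Suc (L w)) (root_poly \<alpha> (v (\<alpha> i)) * q v)"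
      by (simp only: pq[OF v])
  qed (use root v homogeneous_root_poly in auto)
  moreover have "q v = 0" if v: "v \<in> W" "L v \<le> L w" "v \<noteq> w" for v
  proof -
    have "v \<circ> r i \<noteq> w \<circ> r i"
      using v(3) by (simp add: comp_reflection_eq_iff)
    moreover have "L (v \<circ> r i) \<le> Suc (L w)"
      using len_simple_le[OF v(1), of i] v(2) by simp
    moreover have "v \<noteq> w \<circ> r i"
      using v(2) len by auto
    ultimately have "p (v \<circ> r i) - p v = 0"
      using p' v vr by simp
    then show ?thesis
      using pq[OF v(1)] root[OF v(1)] by (simp add: H_mult_eq_0_iff)
  qed
  moreover have "q w = inv_prod w"
  proof -
    have "w \<noteq> w \<circ> r i"
      using len by auto
    then have "p w = 0"
      using p' w by simp
    then have "root_poly \<alpha> (w (\<alpha> i)) * q w = root_poly \<alpha> (w (\<alpha> i)) * inv_prod w"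
      using pq[OF w] p' inv_prod_up[OF w up] by simp
    then show ?thesis
      using root[OF w] by (simp add: H_mult_left_cancel)
  qed
  ultimately show ?thesis
    using q is_schubert_class_iff[OF w] by blast
qed

lemma len_le: "w \<in> W \<Longrightarrow> L w \<le> card P"
  using card_mono[OF finite_pos_roots, of "invs w"] card_invs invs_pos by fastforce

lemma schubert_class_exists: "w \<in> W \<Longrightarrow> \<exists>p. is_schubert_class \<Phi> \<alpha> w p"
proof (induction "card P - L w" arbitrary: w rule: less_induct)
  case less
  show ?case
  proof (cases "\<exists>i. w (\<alpha> i) \<in> P")
    case True
    then obtain i where i: "w (\<alpha> i) \<in> P"
      by blast
    have wr: "w \<circ> r i \<in> W"
      using less.prems by (simp add: weyl_comp_reflection)
    then have "card P - L (w \<circ> r i) < card P - L w"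
      using len_simple_up[OF less.prems i] len_le[OF wr] by simp
    then obtain p where p: "is_schubert_class \<Phi> \<alpha> (w \<circ> r i) p"
      using less.hyps wr by blast
    then have "gkm p"
      by (simp add: is_schubert_class_def)
    from divided_difference[OF this, of i] obtain q
      where "gkm q" "\<forall>v\<in>W. p (v \<circ> r i) - p v = root_poly \<alpha> (v (\<alpha> i)) * q v"
      by (elim exE conjE)
    then have "is_schubert_class \<Phi> \<alpha> w q"
      by (intro schubert_class_down[OF less.prems i p]) simp_all
    then show ?thesis
      by (rule exI[of _ q])
  next
    case False
    then have invs: "invs w = P"
      using invs_all_down less.prems by blast
    \<comment> \<open>All positive roots occur in \<open>inv_prod w\<close>, so every root divides
      it and the GKM conditions hold for a class supported at one point.\<close>
    define p where "p v = (if v = w then inv_prod w else 0)" for v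
    have "root_poly \<alpha> \<beta> dvd inv_prod w" if "\<beta> \<in> \<Phi>" for \<beta>
    proof -
      have pos: "root_poly \<alpha> \<gamma> dvd inv_prod w" if "\<gamma> \<in> P" for \<gamma>
        unfolding inv_prod_def invs using finite_pos_roots that by (intro dvd_prodI) auto
      show ?thesis
        using root_cases[OF \<open>\<beta> \<in> \<Phi>\<close>] pos root_poly_uminus[OF \<open>\<beta> \<in> \<Phi>\<close>] by (metis minus_dvd_iff)
    qed
    then have "gkm p"
      using less.prems by (auto simp: gkm_class_def p_def)
    then have "is_schubert_class \<Phi> \<alpha> w p"
      using less.prems homogeneous_inv_prod by (auto simp: is_schubert_class_iff p_def)
    then show ?thesis
      by (rule exI[of _ p])
  qed
qed

section \<open>The Schubert classes as an \<open>H\<close>-basis\<close>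

abbreviation "S \<equiv> schubert \<Phi> \<alpha>"

lemma schubert_is_class:
  assumes "w \<in> W"
  shows "is_schubert_class \<Phi> \<alpha> w (S w)"
proof -
  have "\<exists>!p. is_schubert_class \<Phi> \<alpha> w p"
    using schubert_class_exists[OF assms] schubert_class_unique[OF assms] by (rule ex_ex1I)
  then show ?thesis
    unfolding schubert_def by (rule theI')
qed

lemma schubert_eqI: "w \<in> W \<Longrightarrow> is_schubert_class \<Phi> \<alpha> w p \<Longrightarrow> S w = p"
  using schubert_is_class schubert_class_unique by blast

lemma gkm_schubert: "w \<in> W \<Longrightarrow> gkm (S w)"
  and homogeneous_schubert: "w \<in> W \<Longrightarrow> v \<in> W \<Longrightarrow> homogeneous (L w) (S w v)"
  and schubert_eq_0: "w \<in> W \<Longrightarrow> v \<in> W \<Longrightarrow> L v \<le> L w \<Longrightarrow> v \<noteq> w \<Longrightarrow> S w v = 0"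
  and schubert_self: "w \<in> W \<Longrightarrow> S w w = inv_prod w"
  using schubert_is_class[of w] is_schubert_class_iff[of w "S w"] by blast+

text \<open>Any divided difference of the upper class is a Schubert class for \<open>w\<close>, and
  uniqueness identifies it with \<open>S w\<close>.\<close>

lemma schubert_difference:
  assumes w: "w \<in> W" and up: "w (\<alpha> i) \<in> P" and v: "v \<in> W"
  shows "S (w \<circ> r i) (v \<circ> r i) - S (w \<circ> r i) v = root_poly \<alpha> (v (\<alpha> i)) * S w v"
proof -
  have wr: "w \<circ> r i \<in> W"
    using w by (simp add: weyl_comp_reflection)
  from divided_difference[OF gkm_schubert[OF wr], of i] obtain q where q: "gkm q"
    "\<forall>v\<in>W. S (w \<circ> r i) (v \<circ> r i) - S (w \<circ> r i) v = root_poly \<alpha> (v (\<alpha> i)) * q v"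
    by (elim exE conjE)
  then have "is_schubert_class \<Phi> \<alpha> w q"
    by (intro schubert_class_down[OF w up schubert_is_class[OF wr]]) simp_all
  then have "S w = q"
    by (rule schubert_eqI[OF w])
  then show ?thesis
    using q(2) v by simp
qed

text \<open>The operator squares to zero: \<open>S w\<close> is itself a divided difference, and
  passing from \<open>v\<close> to \<open>v \<circ> r i\<close> reverses the signs of numerator and
  denominator.\<close>

lemma schubert_invariant:
  assumes w: "w \<in> W" and up: "w (\<alpha> i) \<in> P" and v: "v \<in> W"
  shows "S w (v \<circ> r i) = S w v"
proof -
  have vr: "v \<circ> r i \<in> W" and root: "v (\<alpha> i) \<in> \<Phi>"
    using v by (simp_all add: weyl_comp_reflection weyl_root)
  have "(v \<circ> r i) (\<alpha> i) = - v (\<alpha> i)"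
    using v by (simp add: reflection_self weyl_neg)
  then have "S (w \<circ> r i) v - S (w \<circ> r i) (v \<circ> r i) = - root_poly \<alpha> (v (\<alpha> i)) * S w (v \<circ> r i)"
    using schubert_difference[OF w up vr] unfolding reflection_comp_self_right
    by (simp only: root_poly_uminus[OF root])
  then have "root_poly \<alpha> (v (\<alpha> i)) * S w (v \<circ> r i) = root_poly \<alpha> (v (\<alpha> i)) * S w v"
    using schubert_difference[OF w up v] by (simp add: algebra_simps)
  then show ?thesis
    using root_poly_nonzero[OF root] by (simp add: H_mult_left_cancel)
qed

text \<open>Triangularity by length: at \<open>u\<close>, the shorter classes have zero coefficient
  by induction, and all others except \<open>S u\<close> vanish.\<close>

lemma schubert_independent:
  assumes "\<And>x. x \<in> W \<Longrightarrow> (\<Sum>u\<in>W. c u * S u x) = 0" and "u \<in> W"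
  shows "c u = 0"
  using assms(2)
proof (induction "L u" arbitrary: u rule: less_induct)
  case less
  have "c x * S x u = 0" if "x \<in> W - {u}" for x
    using that less schubert_eq_0[of x u] by (cases "L x < L u") auto
  then have "(\<Sum>x\<in>W. c x * S x u) = c u * S u u"
    using less.prems finite_weyl by (subst sum.remove[of _ u]) auto
  then have "c u * inv_prod u = 0"
    using assms(1)[OF less.prems] schubert_self[OF less.prems] by simp
  then show ?case
    using inv_prod_nonzero by (simp add: H_mult_eq_0_iff)
qed

text \<open>Elimination by length. Once a class vanishes below length \<open>n\<close>, its values
  at length \<open>n\<close> are multiples of \<open>inv_prod\<close>; since classes of equal length
  do not interfere there, one subtraction clears the whole layer.\<close>

lemma schubert_expansion:
  assumes "gkm p"
  shows "\<exists>c. \<forall>x\<in>W. p x = (\<Sum>u\<in>W. c u * S u x)"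
proof -
  have "\<exists>c. \<forall>x\<in>W. p x = (\<Sum>u\<in>W. c u * S u x)"
    if "gkm p" "\<And>x. x \<in> W \<Longrightarrow> L x < n \<Longrightarrow> p x = 0" "n \<le> Suc (card P)" for n p
    using that(3,1,2)
  \<comment> \<open>The induction runs downwards from \<open>Suc (card P)\<close>, which exceeds
    every length, to the desired case 0.\<close>
  proof (induction n arbitrary: p rule: inc_induct)
    case base
    then have "p x = 0" if "x \<in> W" for x
      using that len_le by (simp add: less_Suc_eq_le)
    then show ?case
      by (intro exI[of _ "\<lambda>_. 0"]) simp
  next
    case (step n)
    have "\<exists>a. L v = n \<and> v \<in> W \<longrightarrow> p v = a * inv_prod v" for v
      using inv_prod_dvd[OF step.prems(1), of v] step.prems(2) by (metis dvd_def mult.commute)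
    then obtain a where a: "\<And>v. v \<in> W \<Longrightarrow> L v = n \<Longrightarrow> p v = a v * inv_prod v"
      by metis
    define b where "b v = (if L v = n then a v else 0)" for v
    define q where "q x = p x - (\<Sum>u\<in>W. b u * S u x)" for x
    have "gkm q"
      unfolding q_def
      by (intro gkm_diff gkm_sum gkm_scale gkm_schubert step.prems(1))
    moreover have "q x = 0" if x: "x \<in> W" "L x < Suc n" for x
    proof -
      have "b u * S u x = 0" if "u \<in> W - {x}" for u
        using that x schubert_eq_0[of u x] by (auto simp: b_def)
      then have "(\<Sum>u\<in>W. b u * S u x) = b x * inv_prod x"
        using x finite_weyl by (subst sum.remove[of _ x]) (auto simp: schubert_self)
      then show ?thesis
        using x a step.prems(2) by (cases "L x = n") (auto simp: q_def b_def)
    qed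
    ultimately obtain c where c: "\<forall>x\<in>W. q x = (\<Sum>u\<in>W. c u * S u x)"
      using step.IH by blast
    have "p x = (\<Sum>u\<in>W. (c u + b u) * S u x)" if "x \<in> W" for x
      using c that by (simp add: q_def sum.distrib algebra_simps)
    then show ?case
      by (intro exI[of _ "\<lambda>u. c u + b u"]) simp
  qed
  from this[of p 0] show ?thesis
    using assms by simp
qed

section \<open>Structure constants\<close>

abbreviation "C \<equiv> struct_const \<Phi> \<alpha>"

lemma struct_const:
  assumes "w \<in> W" "v \<in> W" "x \<in> W"
  shows "S w x * S v x = (\<Sum>u\<in>W. C w v u * S u x)"
proof -
  have "gkm (\<lambda>x. S w x * S v x)"
    using assms gkm_mult gkm_schubert by blast
  from schubert_expansion[OF this]
  obtain c where c: "\<forall>x\<in>W. S w x * S v x = (\<Sum>u\<in>W. c u * S u x)" ..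
  define Q where "Q c \<longleftrightarrow> (\<forall>x\<in>W. S w x * S v x = (\<Sum>u\<in>W. c u * S u x)) \<and>
    (\<forall>u. u \<notin> W \<longrightarrow> c u = 0)" for c
  \<comment> \<open>Independence controls coefficients on \<open>W\<close> only; cutting off by zero
    elsewhere makes the function unique.\<close>
  have "Q (\<lambda>u. if u \<in> W then c u else 0)"
    using c by (auto simp: Q_def intro!: sum.cong)
  moreover have "d = e" if "Q d" "Q e" for d e
  proof
    fix u
    have "(\<Sum>u\<in>W. (d u - e u) * S u x) = 0" if "x \<in> W" for x
      using \<open>Q d\<close> \<open>Q e\<close> that by (simp add: Q_def left_diff_distrib sum_subtractf)
    then have "d u - e u = 0" if "u \<in> W"
      using schubert_independent[of "\<lambda>u. d u - e u"] that by blast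
    then show "d u = e u"
      using \<open>Q d\<close> \<open>Q e\<close> by (cases "u \<in> W") (auto simp: Q_def)
  qed
  ultimately have "\<exists>!c. Q c"
    by blast
  from theI'[OF this] show ?thesis
    using assms(3) unfolding struct_const_def Q_def by blast
qed

subsection \<open>The equivariant Chevalley formula\<close>

lemma pairing_scale:
  assumes "\<beta> \<in> \<Phi>" "\<gamma> \<in> \<Phi>"
  shows "reflection \<beta> \<gamma> = \<gamma> - of_int (pairing \<gamma> \<beta>) *\<^sub>R \<beta>"
proof -
  obtain k :: int where k: "reflection \<beta> \<gamma> = \<gamma> - of_int k *\<^sub>R \<beta>"
    by (rule reflection_int[OF assms])
  have "pairing \<gamma> \<beta> = k"
    unfolding pairing_def using k assms(1) zero_not_root by (intro the_equality) auto
  then show ?thesis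
    using k by simp
qed

lemma pairing_self: "\<beta> \<in> \<Phi> \<Longrightarrow> pairing \<beta> \<beta> = 2"
proof -
  assume \<beta>: "\<beta> \<in> \<Phi>"
  have "- \<beta> = \<beta> - of_int (pairing \<beta> \<beta>) *\<^sub>R \<beta>"
    using pairing_scale[OF \<beta> \<beta>] by (simp only: reflection_self)
  then have "of_int (pairing \<beta> \<beta>) *\<^sub>R \<beta> = 2 *\<^sub>R \<beta>"
    by (simp add: scaleR_2 algebra_simps)
  then show ?thesis
    using \<beta> zero_not_root by auto
qed

text \<open>
  By induction on length: a right descent of \<open>w \<circ> reflection \<beta>\<close> is either a descent of \<open>w\<close>,
  and divided differences reduce the claim to shorter elements, or equal to \<open>\<beta>\<close>.
\<close>

lemma schubert_cover:
  assumes "w \<in> W" "\<beta> \<in> P" "L (w \<circ> reflection \<beta>) = Suc (L w)"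
  shows "root_poly \<alpha> (w \<beta>) * S w (w \<circ> reflection \<beta>) = inv_prod (w \<circ> reflection \<beta>)"
  using assms
proof (induction "L w" arbitrary: w \<beta> rule: less_induct)
  case less
  note w = less.prems(1) and \<beta> = less.prems(2)
  have \<beta>root: "\<beta> \<in> \<Phi>"
    using \<beta> pos_root_root by blast
  define u where "u = w \<circ> reflection \<beta>"
  have u: "u \<in> W" "L u = Suc (L w)"
    using less.prems \<beta>root by (simp_all add: u_def weyl_comp_reflection)
  then obtain i where i: "u (\<alpha> i) \<notin> P"
    using exists_descent[of u] by auto
  have w\<beta>: "w \<beta> \<in> P"
    using len_reflection_greater_iff[OF w \<beta>] less.prems(3) by simp
  have u_left: "u = reflection (w \<beta>) \<circ> w"
    unfolding u_def using weyl_reflection_conj[OF w] .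
  define x where "x = u \<circ> r i"
  have x: "x \<in> W" "u = x \<circ> r i" "L x = L w" "x (\<alpha> i) \<in> P"
    using u i len_simple_down[OF u(1) i]
    by (auto simp: x_def weyl_comp_reflection reflection_self weyl_neg pos_neg_iff weyl_root)
  show ?case
  proof (cases "w (\<alpha> i) \<in> P")
    case True
    show ?thesis
    proof (cases "\<beta> = \<alpha> i")
      case True
      then show ?thesis
        using schubert_invariant[OF w \<open>w (\<alpha> i) \<in> P\<close> w] schubert_self[OF w]
          inv_prod_up[OF w \<open>w (\<alpha> i) \<in> P\<close>] by simp
    next
      case False
      have "r i \<beta> \<in> P"
        using simple_reflection_pos[OF \<beta> False] .
      have wr: "w \<circ> r i \<in> W" "(w \<circ> r i) (r i \<beta>) = w \<beta>"
        using w by (simp_all add: weyl_comp_reflection)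
      \<comment> \<open>This case is impossible: \<open>x\<close> would lie above
        \<open>w \<circ> r i\<close>, yet \<open>x\<close> has length \<open>L w\<close> and
        \<open>w \<circ> r i\<close> has length \<open>Suc (L w)\<close>.\<close>
      have "L (w \<circ> r i) < L (w \<circ> r i \<circ> reflection (r i \<beta>))"
        using len_reflection_greater[OF wr(1) \<open>r i \<beta> \<in> P\<close>] w\<beta> unfolding wr(2) by blast
      moreover have "w \<circ> r i \<circ> reflection (r i \<beta>) = x"
        unfolding x_def u_left weyl_reflection_conj[OF wr(1)] wr(2) by (simp add: comp_assoc)
      ultimately have False
        using len_simple_up[OF w True] x(3) by simp
      then show ?thesis ..
    qed
  next
    case False
    define y where "y = w \<circ> r i"
    have y: "y \<in> W" "w = y \<circ> r i" "L w = Suc (L y)" "y (\<alpha> i) \<in> P"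
      using w False len_simple_down[OF w False]
      by (auto simp: y_def weyl_comp_reflection reflection_self weyl_neg pos_neg_iff weyl_root)
    have "\<beta> \<noteq> \<alpha> i"
      using w\<beta> False by auto
    then have r\<beta>: "r i \<beta> \<in> P"
      using simple_reflection_pos[OF \<beta>] by blast
    have y\<beta>: "y (r i \<beta>) = w \<beta>"
      by (simp add: y_def)
    have yx: "y \<circ> reflection (r i \<beta>) = x"
      unfolding x_def u_left weyl_reflection_conj[OF y(1)] y\<beta> by (simp add: y_def comp_assoc)
    have IH: "root_poly \<alpha> (w \<beta>) * S y x = inv_prod x"
      using less.hyps[of y "r i \<beta>"] y r\<beta> x(3) unfolding yx y\<beta> by simp
    \<comment> \<open>Having equal length and being distinct from \<open>w\<close>, the point
      \<open>x\<close> is a zero of \<open>S w\<close>, so only one term of the divided difference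
      remains.\<close>
    have "x \<noteq> w"
      using y(4) x(4) False by auto
    then have "S w x = 0"
      using schubert_eq_0[OF w x(1)] x(3) by simp
    then have "S w u = root_poly \<alpha> (x (\<alpha> i)) * S y x"
      using schubert_difference[OF y(1,4) x(1)] by (simp flip: x(2) y(2))
    then have "root_poly \<alpha> (w \<beta>) * S w u = root_poly \<alpha> (x (\<alpha> i)) * inv_prod x"
      by (simp flip: IH add: algebra_simps)
    also have "\<dots> = inv_prod u"
      using inv_prod_up[OF x(1,4)] by (simp flip: x(2))
    finally show ?thesis
      by (simp only: u_def)
  qed
qed

text \<open>No reflection takes \<open>u\<close> to \<open>w\<close>, so the GKM conditions make all
  \<open>L u\<close> inversions of \<open>u\<close> divide a value of degree only
  \<open>L w\<close>.\<close>

lemma schubert_not_cover: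
  assumes "w \<in> W" "u \<in> W" "L u = Suc (L w)"
    and "\<And>\<beta>. \<beta> \<in> P \<Longrightarrow> u \<noteq> w \<circ> reflection \<beta>"
  shows "S w u = 0"
proof (rule homogeneous_dvd_imp_0)
  show "homogeneous (L w) (S w u)" "homogeneous (L u) (inv_prod u)" "L w < L u"
    using assms homogeneous_schubert homogeneous_inv_prod[OF assms(2)] by auto
  show "inv_prod u dvd S w u"
    unfolding inv_prod_def
  proof (rule prod_root_poly_dvd)
    show "invs u \<subseteq> P"
      using invs_pos by blast
    fix \<gamma>
    assume \<gamma>: "\<gamma> \<in> invs u"
    then have P: "\<gamma> \<in> P" and root: "\<gamma> \<in> \<Phi>"
      using invs_pos pos_root_root by blast+
    have "L (reflection \<gamma> \<circ> u) < L u"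
      using \<gamma> P reflection_len_less_iff assms(2) by blast
    moreover have u': "reflection \<gamma> \<circ> u \<in> W"
      using assms(2) root by (rule weyl_reflection)
    moreover have "reflection \<gamma> \<circ> u \<noteq> w"
    proof
      assume eq: "reflection \<gamma> \<circ> u = w"
      from \<gamma> obtain \<beta> where \<beta>: "\<beta> \<in> P" "u \<beta> = - \<gamma>"
        by (auto simp: invs_def)
      have "w = u \<circ> reflection \<beta>"
        unfolding eq[symmetric] weyl_reflection_conj[OF assms(2)] \<beta>(2) by simp
      then have "u = w \<circ> reflection \<beta>"
        by (simp only: reflection_comp_self_right)
      then show False
        using assms(4) \<beta>(1) by blast
    qed
    ultimately have "S w (reflection \<gamma> \<circ> u) = 0"
      using schubert_eq_0[OF assms(1) u'] assms(3) by simp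
    then show "root_poly \<alpha> \<gamma> dvd S w u"
      using gkm_dvd[OF gkm_schubert[OF assms(1)] assms(2) root] by simp
  qed
qed

text \<open>Along a reflection, covering is a condition on lengths. For an ascent
  \<open>w (\<alpha> i) \<in> P\<close> the root \<open>\<alpha> i\<close> belongs to this set,
  unlike in the sum of the theorem.\<close>

definition cover_roots :: "('v \<Rightarrow> 'v) \<Rightarrow> 'v set"
  where "cover_roots w = {\<beta>\<in>P. L (w \<circ> reflection \<beta>) = Suc (L w)}"

lemma finite_cover_roots: "finite (cover_roots w)"
  using finite_pos_roots by (simp add: cover_roots_def)

lemma comp_reflection_inject:
  assumes "w \<in> W" "\<beta> \<in> P" "\<gamma> \<in> P" "w \<circ> reflection \<beta> = w \<circ> reflection \<gamma>"
  shows "\<beta> = \<gamma>"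
proof -
  have "reflection \<beta> x = reflection \<gamma> x" for x
    using fun_cong[OF assms(4), of x] weyl_inj[OF assms(1)] by simp
  then show ?thesis
    using reflection_eq_imp_eq assms(2,3) by blast
qed

text \<open>Subtracting the constant \<open>w (\<alpha> i)\<close> from the class
  \<open>v (\<alpha> i)\<close> gives \<open>p\<close>, which vanishes at \<open>w\<close>. At a
  cover \<open>x = w \<circ> reflection \<beta>\<close> it equals
  \<open>- pairing (\<alpha> i) \<beta>\<close> times \<open>w \<beta>\<close>, and
  \<open>schubert_cover\<close> turns its product with \<open>S w x\<close> into the same multiple
  of \<open>inv_prod x\<close>. The corrected product \<open>q\<close> has degree
  \<open>Suc (L w)\<close> and vanishes up to that length, so it is zero.\<close>

lemma chevalley:
  assumes w: "w \<in> W" and v: "v \<in> W"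
  shows "root_poly \<alpha> (v (\<alpha> i)) * S w v = root_poly \<alpha> (w (\<alpha> i)) * S w v -
    (\<Sum>\<beta>\<in>cover_roots w. of_int (pairing (\<alpha> i) \<beta>) * S (w \<circ> reflection \<beta>) v)"
proof -
  define p where "p v = (if v \<in> W then root_poly \<alpha> (v (\<alpha> i)) - root_poly \<alpha> (w (\<alpha> i)) else 0)" for v
  define q where "q v = p v * S w v +
    (\<Sum>\<beta>\<in>cover_roots w. of_int (pairing (\<alpha> i) \<beta>) * S (w \<circ> reflection \<beta>) v)" for v
  have cov: "w \<circ> reflection \<beta> \<in> W" "L (w \<circ> reflection \<beta>) = Suc (L w)" "\<beta> \<in> P" "\<beta> \<in> \<Phi>"
    if "\<beta> \<in> cover_roots w" for \<beta>
    using that w pos_root_root weyl_comp_reflection by (auto simp: cover_roots_def)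
  have "root_poly \<alpha> \<beta> dvd p x - p (reflection \<beta> \<circ> x)" if x: "x \<in> W" and \<beta>: "\<beta> \<in> \<Phi>" for x \<beta>
  proof -
    have root: "x (\<alpha> i) \<in> \<Phi>"
      using x by (simp add: weyl_root)
    have "root_poly \<alpha> (reflection \<beta> (x (\<alpha> i))) =
        root_poly \<alpha> (x (\<alpha> i)) - of_int (pairing (x (\<alpha> i)) \<beta>) * root_poly \<alpha> \<beta>"
      using root_poly_diff_scale[OF root \<beta>] pairing_scale[OF \<beta> root] by simp
    then show ?thesis
      using x weyl_reflection[OF x \<beta>] by (simp add: p_def)
  qed
  then have "gkm p"
    by (simp add: gkm_class_def p_def)
  then have "gkm q"
    unfolding q_def using w cov
    by (intro gkm_add gkm_mult gkm_sum gkm_scale gkm_schubert) auto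
  have "q v = 0"
  proof (rule gkm_vanishing[OF \<open>gkm q\<close>])
    fix x
    assume x: "x \<in> W"
    have "homogeneous 1 (p x)"
      unfolding p_def using homogeneous_root_poly by (auto intro: homogeneous_diff)
    then have "homogeneous (Suc (L w)) (p x * S w x)"
      using homogeneous_mult[of 1 _ "L w"] homogeneous_schubert[OF w x] by simp
    moreover have "homogeneous (Suc (L w)) (S (w \<circ> reflection \<beta>) x)" if "\<beta> \<in> cover_roots w" for \<beta>
      using homogeneous_schubert[OF cov(1)[OF that] x] cov(2)[OF that] by simp
    ultimately show "homogeneous (Suc (L w)) (q x)"
      unfolding q_def by (intro homogeneous_add homogeneous_sum homogeneous_of_int_mult)
    assume len: "L x \<le> Suc (L w)"
    have S0: "S (w \<circ> reflection \<beta>) x = 0" if "\<beta> \<in> cover_roots w" "x \<noteq> w \<circ> reflection \<beta>" for \<beta>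
      using schubert_eq_0[OF cov(1)[OF that(1)] x] len cov(2)[OF that(1)] that(2) by simp
    show "q x = 0"
    proof (cases "\<exists>\<beta>\<in>cover_roots w. x = w \<circ> reflection \<beta>")
      case True
      then obtain \<beta> where \<beta>: "\<beta> \<in> cover_roots w" and x_eq: "x = w \<circ> reflection \<beta>"
        by blast
      have root: "w (\<alpha> i) \<in> \<Phi>" "w \<beta> \<in> \<Phi>"
        using w cov(4)[OF \<beta>] by (simp_all add: weyl_root)
      have "of_int (pairing (\<alpha> i) \<gamma>) * S (w \<circ> reflection \<gamma>) x = 0"
        if "\<gamma> \<in> cover_roots w - {\<beta>}" for \<gamma>
      proof -
        have "x \<noteq> w \<circ> reflection \<gamma>"
          using that comp_reflection_inject[OF w cov(3)[OF \<beta>] cov(3)[of \<gamma>]] x_eq by auto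
        then show ?thesis
          using that S0[of \<gamma>] by simp
      qed
      then have "(\<Sum>\<gamma>\<in>cover_roots w. of_int (pairing (\<alpha> i) \<gamma>) * S (w \<circ> reflection \<gamma>) x) =
          of_int (pairing (\<alpha> i) \<beta>) * S x x"
        using \<beta> finite_cover_roots by (subst sum.remove[of _ \<beta>]) (auto simp: x_eq)
      moreover have "x (\<alpha> i) = w (\<alpha> i) - of_int (pairing (\<alpha> i) \<beta>) *\<^sub>R w \<beta>"
        using pairing_scale[OF cov(4)[OF \<beta>] simple_root[of i]] weyl_linear[OF w]
        by (simp add: x_eq linear_diff linear_scale)
      then have "p x = - (of_int (pairing (\<alpha> i) \<beta>) * root_poly \<alpha> (w \<beta>))"
        using x root_poly_diff_scale[OF root] by (simp add: p_def)
      ultimately have "q x = of_int (pairing (\<alpha> i) \<beta>) * (S x x - root_poly \<alpha> (w \<beta>) * S w x)"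
        by (simp add: q_def algebra_simps)
      then show ?thesis
        using schubert_cover[OF w cov(3)[OF \<beta>] cov(2)[OF \<beta>]] schubert_self[OF x] by (simp add: x_eq)
    next
      case False
      \<comment> \<open>Away from the covers, \<open>p\<close> vanishes at \<open>w\<close>, and
        \<open>S w\<close> vanishes at the other elements of length at most
        \<open>Suc (L w)\<close>.\<close>
      have "p x * S w x = 0"
      proof (cases "x = w")
        case False
        have "S w x = 0"
        proof (cases "L x \<le> L w")
          case True
          then show ?thesis
            using schubert_eq_0[OF w x] False by blast
        next
          case False
          then have lx: "L x = Suc (L w)"
            using len by simp
          have "x \<noteq> w \<circ> reflection \<beta>" if "\<beta> \<in> P" for \<beta>
            using \<open>\<not> (\<exists>\<beta>\<in>cover_roots w. x = w \<circ> reflection \<beta>)\<close> lx that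
            by (auto simp: cover_roots_def)
          then show ?thesis
            using schubert_not_cover[OF w x lx] by blast
        qed
        then show ?thesis
          by simp
      qed (simp add: p_def)
      then show ?thesis
        using S0 False by (auto simp: q_def intro!: sum.neutral)
    qed
  qed
  then show ?thesis
    using v by (simp add: q_def p_def algebra_simps)
qed

section \<open>Comparing coefficients in the Leibniz rule\<close>

lemma struct_const_recursion:
  assumes u: "u \<in> W" "u (\<alpha> i) \<in> P" and v: "v \<in> W" "v (\<alpha> i) \<in> P" and w: "w \<in> W" "w (\<alpha> i) \<in> P"
  shows "C w (v \<circ> r i) u = C (w \<circ> r i) (v \<circ> r i) (u \<circ> r i) - C (w \<circ> r i) v u
    - root_poly \<alpha> (w (\<alpha> i)) * C w v u
    + (\<Sum>\<beta>\<in>cover_roots w. of_int (pairing (\<alpha> i) \<beta>) * C (w \<circ> reflection \<beta>) v u)"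
proof -
  define c where "c = C (w \<circ> r i) (v \<circ> r i)"
  \<comment> \<open>The coefficient of \<open>S x\<close> in the Leibniz identity with the Chevalley
    formula inserted and everything moved to one side. Only ascents \<open>x\<close> carry the term
    \<open>c (x \<circ> r i)\<close>, because the operator sends \<open>S (x \<circ> r i)\<close> to
    \<open>S x\<close> for them and kills their own classes. The sum still contains
    \<open>\<beta> = \<alpha> i\<close>.\<close>
  define d where "d x = C w (v \<circ> r i) x + C (w \<circ> r i) v x + root_poly \<alpha> (w (\<alpha> i)) * C w v x
    - (\<Sum>\<beta>\<in>cover_roots w. of_int (pairing (\<alpha> i) \<beta>) * C (w \<circ> reflection \<beta>) v x)
    - (if x (\<alpha> i) \<in> P then c (x \<circ> r i) else 0)" for x
  have r: "x \<circ> r i \<in> W" if "x \<in> W" for x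
    using that by (simp add: weyl_comp_reflection)
  have "(\<Sum>x\<in>W. d x * S x y) = 0" if y: "y \<in> W" for y
  proof -
    let ?a = "root_poly \<alpha> (y (\<alpha> i))"
    define U where "U = {x\<in>W. x (\<alpha> i) \<in> P}"
    \<comment> \<open>Right multiplication by the simple reflection exchanges ascents and
      descents.\<close>
    have "bij_betw (\<lambda>x. x \<circ> r i) U (W - U)"
    proof (rule bij_betwI[where g = "\<lambda>x. x \<circ> r i"])
      show "(\<lambda>x. x \<circ> r i) \<in> U \<rightarrow> W - U" "(\<lambda>x. x \<circ> r i) \<in> W - U \<rightarrow> U"
        using r by (auto simp: U_def reflection_self weyl_neg weyl_root pos_neg_iff not_pos_neg)
    qed simp_all
    then have reindex: "(\<Sum>x\<in>W - U. f x) = (\<Sum>x\<in>U. f (x \<circ> r i))" for f :: "('v \<Rightarrow> 'v) \<Rightarrow> 'i H"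
      using sum.reindex_bij_betw[of _ U "W - U" f] by simp
    have "S (w \<circ> r i) (y \<circ> r i) * S (v \<circ> r i) (y \<circ> r i) - S (w \<circ> r i) y * S (v \<circ> r i) y =
        (\<Sum>x\<in>W. c x * (S x (y \<circ> r i) - S x y))"
      using struct_const[OF r r r, OF w(1) v(1) y] struct_const[OF r r y, OF w(1) v(1)]
      by (simp add: c_def sum_subtractf right_diff_distrib)
    \<comment> \<open>By invariance the classes of ascents drop out of the difference.\<close>
    also have "\<dots> = (\<Sum>x\<in>W - U. c x * (S x (y \<circ> r i) - S x y))"
      using schubert_invariant y finite_weyl by (intro sum.mono_neutral_right) (auto simp: U_def)
    also have "\<dots> = (\<Sum>x\<in>U. c (x \<circ> r i) * (S (x \<circ> r i) (y \<circ> r i) - S (x \<circ> r i) y))"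
      by (rule reindex)
    also have "\<dots> = (\<Sum>x\<in>U. ?a * (c (x \<circ> r i) * S x y))"
      using schubert_difference y by (intro sum.cong) (auto simp: U_def)
    also have "\<dots> = ?a * (\<Sum>x\<in>U. c (x \<circ> r i) * S x y)"
      by (simp add: sum_distrib_left)
    also have "(\<Sum>x\<in>U. c (x \<circ> r i) * S x y) = (\<Sum>x\<in>W. (if x (\<alpha> i) \<in> P then c (x \<circ> r i) else 0) * S x y)"
      using finite_weyl by (intro sum.mono_neutral_cong_left) (auto simp: U_def)
    finally have *: "S (w \<circ> r i) (y \<circ> r i) * S (v \<circ> r i) (y \<circ> r i) - S (w \<circ> r i) y * S (v \<circ> r i) y =
      ?a * (\<Sum>x\<in>W. (if x (\<alpha> i) \<in> P then c (x \<circ> r i) else 0) * S x y)" .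
    have "S (w \<circ> r i) (y \<circ> r i) = S (w \<circ> r i) y + ?a * S w y"
      "S (v \<circ> r i) (y \<circ> r i) = S (v \<circ> r i) y + ?a * S v y"
      using schubert_difference[OF w y] schubert_difference[OF v y] by (simp_all add: algebra_simps)
    \<comment> \<open>The Leibniz rule with its denominator cleared; the common factor
      \<open>?a\<close> is cancelled afterwards.\<close>
    then have "S (w \<circ> r i) (y \<circ> r i) * S (v \<circ> r i) (y \<circ> r i) - S (w \<circ> r i) y * S (v \<circ> r i) y =
        ?a * (S w y * S (v \<circ> r i) y + S (w \<circ> r i) y * S v y + (?a * S w y) * S v y)"
      by (simp add: algebra_simps)
    from trans[OF this[symmetric] *]
    have "S w y * S (v \<circ> r i) y + S (w \<circ> r i) y * S v y + (?a * S w y) * S v y =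
        (\<Sum>x\<in>W. (if x (\<alpha> i) \<in> P then c (x \<circ> r i) else 0) * S x y)"
      unfolding H_mult_left_cancel[OF root_poly_nonzero[OF weyl_root[OF y simple_root]]] .
    \<comment> \<open>Of the three Leibniz terms, the quadratic one is the one still carrying
      \<open>?a\<close>, which depends on the point \<open>y\<close>; the Chevalley formula trades
      it for coefficients independent of \<open>y\<close>.\<close>
    moreover have "(?a * S w y) * S v y = root_poly \<alpha> (w (\<alpha> i)) * (S w y * S v y) -
        (\<Sum>\<beta>\<in>cover_roots w. of_int (pairing (\<alpha> i) \<beta>) * (S (w \<circ> reflection \<beta>) y * S v y))"
      unfolding chevalley[OF w(1) y] by (simp add: left_diff_distrib sum_distrib_right mult.assoc)
    moreover have "(\<Sum>\<beta>\<in>cover_roots w. of_int (pairing (\<alpha> i) \<beta>) * (S (w \<circ> reflection \<beta>) y * S v y)) =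
        (\<Sum>x\<in>W. (\<Sum>\<beta>\<in>cover_roots w. of_int (pairing (\<alpha> i) \<beta>) * C (w \<circ> reflection \<beta>) v x) * S x y)"
    proof -
      have "S (w \<circ> reflection \<beta>) y * S v y = (\<Sum>x\<in>W. C (w \<circ> reflection \<beta>) v x * S x y)"
        if "\<beta> \<in> cover_roots w" for \<beta>
        using that w(1) v(1) y pos_root_root
        by (intro struct_const) (auto simp: cover_roots_def intro: weyl_comp_reflection)
      then have "(\<Sum>\<beta>\<in>cover_roots w. of_int (pairing (\<alpha> i) \<beta>) * (S (w \<circ> reflection \<beta>) y * S v y)) =
        (\<Sum>\<beta>\<in>cover_roots w. \<Sum>x\<in>W. of_int (pairing (\<alpha> i) \<beta>) * C (w \<circ> reflection \<beta>) v x * S x y)"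
        by (simp add: sum_distrib_left mult.assoc)
      also have "\<dots> = (\<Sum>x\<in>W. \<Sum>\<beta>\<in>cover_roots w. of_int (pairing (\<alpha> i) \<beta>) * C (w \<circ> reflection \<beta>) v x * S x y)"
        by (rule sum.swap)
      finally show ?thesis
        by (simp add: sum_distrib_right)
    qed
    ultimately show ?thesis
      using struct_const[OF w(1) r y, OF v(1)] struct_const[OF r v(1) y, OF w(1)]
        struct_const[OF w(1) v(1) y]
      by (simp add: d_def left_diff_distrib distrib_right sum.distrib sum_subtractf
        sum_distrib_left mult.assoc add_diff_eq)
  qed
  then have "d u = 0"
    using schubert_independent u(1) by blast
  then show ?thesis
    using u(2) by (simp add: d_def c_def algebra_simps)
qed

end

theorem theorem2:
  fixes \<Phi> :: "'v::euclidean_space set" and \<alpha> :: "'i::finite \<Rightarrow> 'v"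
    and i :: 'i and u v w :: "'v \<Rightarrow> 'v"
  assumes "root_system \<Phi>" and "simple_roots \<Phi> \<alpha>"
    and "u \<in> weyl \<Phi>" and "v \<in> weyl \<Phi>" and "w \<in> weyl \<Phi>"
    and "bruhat_less \<Phi> \<alpha> u (u \<circ> reflection (\<alpha> i))"
    and "bruhat_less \<Phi> \<alpha> v (v \<circ> reflection (\<alpha> i))"
    and "bruhat_less \<Phi> \<alpha> w (w \<circ> reflection (\<alpha> i))"
  shows "struct_const \<Phi> \<alpha> w (v \<circ> reflection (\<alpha> i)) u =
      struct_const \<Phi> \<alpha> (w \<circ> reflection (\<alpha> i)) (v \<circ> reflection (\<alpha> i)) (u \<circ> reflection (\<alpha> i))
    + struct_const \<Phi> \<alpha> (w \<circ> reflection (\<alpha> i)) v u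
    - act \<alpha> w (root_poly \<alpha> (\<alpha> i)) * struct_const \<Phi> \<alpha> w v u
    + (\<Sum>\<beta> | \<beta> \<in> pos_roots \<Phi> \<alpha> \<and> covers \<Phi> \<alpha> (w \<circ> reflection \<beta>) w
              \<and> w \<circ> reflection \<beta> \<noteq> w \<circ> reflection (\<alpha> i).
        of_int (pairing (\<alpha> i) \<beta>) * struct_const \<Phi> \<alpha> (w \<circ> reflection \<beta>) v u)"
proof -
  interpret based_root_system \<Phi> \<alpha>
    using assms by unfold_locales
  have up: "x (\<alpha> i) \<in> P" if "x \<in> W" "bruhat_less \<Phi> \<alpha> x (x \<circ> r i)" for x
    using that len_reflection_greater_iff[OF that(1) simple_pos] bruhat_less_len by blast
  have covers: "covers \<Phi> \<alpha> (w \<circ> reflection \<beta>) w \<longleftrightarrow> \<beta> \<in> cover_roots w" if "\<beta> \<in> P" for \<beta>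
    using that bruhat_less_reflection_iff(2)[OF \<open>w \<in> W\<close> pos_root_root[OF that]]
    by (auto simp: covers_def cover_roots_def)
  \<comment> \<open>Excluding the cover by the simple reflection means excluding the root
    \<open>\<alpha> i\<close>, since distinct positive roots give distinct covers.\<close>
  have "{\<beta>. \<beta> \<in> P \<and> covers \<Phi> \<alpha> (w \<circ> reflection \<beta>) w \<and> w \<circ> reflection \<beta> \<noteq> w \<circ> r i} =
      cover_roots w - {\<alpha> i}"
    using covers comp_reflection_inject[OF \<open>w \<in> W\<close> _ simple_pos]
    by (auto simp: cover_roots_def)
  \<comment> \<open>Splitting this root off the sum yields \<open>2 * C (w \<circ> r i) v u\<close>,
    which turns the minus sign of the recursion into a plus.\<close>
  moreover have "\<alpha> i \<in> cover_roots w"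
    using len_simple_up up assms by (simp add: cover_roots_def)
  ultimately show ?thesis
    using struct_const_recursion[of u i v w] up assms
      sum.remove[OF finite_cover_roots, of "\<alpha> i" w
        "\<lambda>\<beta>. of_int (pairing (\<alpha> i) \<beta>) * C (w \<circ> reflection \<beta>) v u"]
    \<comment> \<open>\<open>root_poly_simple\<close> would rewrite the root to a variable and hide
      the redex of \<open>act_root_poly\<close>.\<close>
    by (simp add: act_root_poly[OF \<open>w \<in> W\<close> simple_root] pairing_self del: root_poly_simple)
qed

end
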